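(* Let $d\ge 3$. Then any linear automorphism ${\bf A}$ of $L_{d,d+2}$ is a scalar multiple of a signed permutation induced by a vertex relabeling, i.e., ${\bf A}=c\,{\bf S}{\bf P}$ with $c\in\mathbb C\setminus\{0\}$, ${\bf S}$ diagonal with entries $\pm1$, and ${\bf P}$ a permutation matrix sending $e_{\{i,j\}}$ to $e_{\{\sigma(i),\sigma(j)\}}$ for some permutation $\sigma$ of $\{1,\dots,d+2\}$.
   Context: Let $n=d+2$, $N=\binom n2$, and index coordinates of $\mathbb C^N$ by edges $\{i,j\}$ of $K_n$. For a complex configuration ${\bf p}$ of $n$ points in $\mathbb C^d$, $m({\bf p})\in\mathbb C^N$ has coordinates $m_{ij}({\bf p})=\sum_{k=1}^d({\bf p}_i^k-{\bf p}_j^k)^2$ (no conjugation); $M_{d,n}$ is the image of $m$; $L_{d,n}=s^{-1}(M_{d,n})$ with $s$ the coordinatewise squaring map. A linear automorphism of $L_{d,n}$ is a non-singular $N\times N$ complex matrix mapping $L_{d,n}$ bijectively onto itself. *)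

theory Defs
  imports Complex_Main "HOL-Combinatorics.Permutations"
begin

text \<open>Vertices of K_n are 0,...,n-1; edges are 2-element subsets. Vectors of C^N are
  functions on edges, extended by 0 outside the edge set.\<close>

definition edges :: "nat \<Rightarrow> nat set set" where
  "edges n = {e. e \<subseteq> {..<n} \<and> card e = 2}"

definition edge_space :: "nat \<Rightarrow> (nat set \<Rightarrow> complex) set" where
  "edge_space n = {v. \<forall>e. e \<notin> edges n \<longrightarrow> v e = 0}"

text \<open>Configuration: p i k is the k-th coordinate of point i (i < d+2, k < d).
  The measurement m_ij(p) = sum_k (p_i^k - p_j^k)^2, without conjugation.\<close>

definition meas :: "nat \<Rightarrow> (nat \<Rightarrow> nat \<Rightarrow> complex) \<Rightarrow> nat set \<Rightarrow> complex" where
  "meas d p e = (if e \<in> edges (d+2)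
     then (\<Sum>k<d. (p (Min e) k - p (Max e) k)^2) else 0)"

definition M_var :: "nat \<Rightarrow> (nat set \<Rightarrow> complex) set" where
  "M_var d = range (meas d)"

definition L_var :: "nat \<Rightarrow> (nat set \<Rightarrow> complex) set" where
  "L_var d = {v \<in> edge_space (d+2). (\<lambda>e. (v e)^2) \<in> M_var d}"

definition mat_app :: "nat \<Rightarrow> (nat set \<Rightarrow> nat set \<Rightarrow> complex) \<Rightarrow> (nat set \<Rightarrow> complex) \<Rightarrow> nat set \<Rightarrow> complex" where
  "mat_app n A v = (\<lambda>e. if e \<in> edges n then (\<Sum>f\<in>edges n. A e f * v f) else 0)"

definition nonsingular :: "nat \<Rightarrow> (nat set \<Rightarrow> nat set \<Rightarrow> complex) \<Rightarrow> bool" where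
  "nonsingular n A \<longleftrightarrow> (\<forall>v\<in>edge_space n. mat_app n A v = (\<lambda>_. 0) \<longrightarrow> v = (\<lambda>_. 0))"

definition linear_automorphism_L :: "nat \<Rightarrow> (nat set \<Rightarrow> nat set \<Rightarrow> complex) \<Rightarrow> bool" where
  "linear_automorphism_L d A \<longleftrightarrow> nonsingular (d+2) A \<and>
     bij_betw (mat_app (d+2) A) (L_var d) (L_var d)"

end

theory Submission
  imports Defs "Jordan_Normal_Form.Determinant" "HOL-Computational_Algebra.Fundamental_Theorem_Algebra"
begin

text \<open>
  Up to a constant, the Gram determinant \<open>F\<close> of the squared edge lengths, based at vertex 0, is the
  Cayley--Menger determinant, and \<open>L\<close> is its zero set. There is a real line on which \<open>F\<close> changes sign
  \<open>deg F\<close> times; this survives small perturbations, so a linear map preserving \<open>L\<close> multiplies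
  \<open>F\<close> by a constant. It therefore preserves the set of directions \<open>v\<close> such that
  \<open>t \<mapsto> F (x + t v)\<close> has degree at most 2 for every \<open>x\<close>. The nonzero ones are exactly the
  signed stars: vectors supported on the edges at one vertex whose entries there all have the same square.

  For \<open>d \<ge> 3\<close> a star has at least four edges. Flipping the sign of one edge of a star cannot change
  the centre of its image: otherwise the four-term relations between a star and its flips at two edges
  would send two different lines to the same one. Hence the image of a unit vector \<open>e\<^bsub>ab\<^esub>\<close> is supported
  on the intersection of two stars, which is a single edge once the map on centres is known to be bijective.
\<close>


text \<open>Vanishing on \<open>L\<close> gives divisibility by \<open>F\<close> only if
  \<open>F\<close> is reduced. The real line settles this: with k = d + 1 it carries 2k distinct
  roots, as many as the degree allows, so the composed form and \<open>F\<close> are proportional on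
  every nearby line. All these lines share one point z with F(z) \<noteq> 0, so the factor is the
  same on all of them.

  Stars grow quadratically because, after a suitable choice of base vertex, only one row and one
  column of the Gram matrix depend on t. For the converse the whole determinant is unwieldy, while
  small principal minors are not: the 2 x 2 minors are Heron's quartic and confine the support to a
  cut of the complete graph, and a 3 x 3 minor excludes cuts with two vertices on each side, which
  leaves the stars.

  The bound d \<ge> 3 matters: for d = 2 there are further automorphisms, the Regge symmetries of
  the tetrahedron, and under these the image of a star can change its centre when one sign is
  flipped. The fourth edge of a star is what separates the vectors in the flip argument.\<close>

section \<open>Determinants with polynomial entries\<close>

text \<open>Row \<open>i\<close> belongs to vertex \<open>Suc i\<close>; vertex 0 is the base point.\<close>
definition gram :: "(nat set \<Rightarrow> 'a::field) \<Rightarrow> nat \<Rightarrow> nat \<Rightarrow> 'a" where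
  "gram m i j = (m {0, Suc i} + m {0, Suc j} - (if i = j then 0 else m {Suc i, Suc j})) / 2"

text \<open>\<open>k\<close> rows mean \<open>k + 1\<close> vertices, hence the edge spaces over
  \<open>Suc k\<close>. As \<open>v\<close> holds lengths and not squared lengths, this is a form of
  degree \<open>2 * k\<close> in \<open>v\<close>.\<close>

definition cm_det :: "nat \<Rightarrow> (nat set \<Rightarrow> 'a::field) \<Rightarrow> 'a" where
  "cm_det k v = det (mat k k (\<lambda>(i, j). gram (\<lambda>e. (v e)\<^sup>2) i j))"

lemma det_mat_leibniz:
  "det (mat k k (\<lambda>(i, j). g i j)) =
    (\<Sum>p | p permutes {0..<k}. signof p * (\<Prod>i = 0..<k. g i (p i)))"
proof -
  have "(\<Prod>i = 0..<k. mat k k (\<lambda>(i, j). g i j) $$ (i, p i)) = (\<Prod>i = 0..<k. g i (p i))"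
    if "p permutes {0..<k}" for p
    by (rule prod.cong) (use that permutes_in_image[OF that] in auto)
  then show ?thesis
    by (subst det_def'[of _ k]) (auto intro!: sum.cong)
qed

lemma det_mat_cong:
  assumes "\<And>i j. i < k \<Longrightarrow> j < k \<Longrightarrow> g i j = h i j"
  shows "det (mat k k (\<lambda>(i, j). g i j)) = det (mat k k (\<lambda>(i, j). h i j))"
  by (rule arg_cong[of _ _ det], rule eq_matI) (use assms in auto)

text \<open>The weight \<open>\<alpha>\<close> is charged once per row and once per column, and each
  Leibniz term meets every row and column exactly once. Weight 1 throughout bounds the degree on an
  arbitrary line; the indicator of one vertex gives degree 2 in a star direction.\<close>

lemma det_poly_entries:
  fixes q :: "nat \<Rightarrow> nat \<Rightarrow> complex poly"
  assumes deg: "\<And>i j. i < k \<Longrightarrow> j < k \<Longrightarrow> degree (q i j) \<le> \<alpha> i + \<alpha> j"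
  obtains P where "degree P \<le> 2 * (\<Sum>i<k. \<alpha> i)"
    and "\<And>t. poly P t = det (mat k k (\<lambda>(i, j). poly (q i j) t))"
proof
  let ?P = "\<Sum>p | p permutes {0..<k}. signof p * (\<Prod>i = 0..<k. q i (p i))"
  show "poly ?P t = det (mat k k (\<lambda>(i, j). poly (q i j) t))" for t
    by (simp add: det_mat_leibniz poly_sum poly_prod)
  show "degree ?P \<le> 2 * (\<Sum>i<k. \<alpha> i)"
  proof (rule degree_sum_le)
    fix p assume "p \<in> {p. p permutes {0..<k}}"
    then have p: "p permutes {0..<k}" by simp
    have "degree (\<Prod>i = 0..<k. q i (p i)) \<le> (\<Sum>i = 0..<k. degree (q i (p i)))"
      using degree_prod_sum_le[of "{0..<k}" "\<lambda>i. q i (p i)"] by (simp add: o_def)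
    also have "\<dots> \<le> (\<Sum>i = 0..<k. \<alpha> i + \<alpha> (p i))"
      by (rule sum_mono, rule deg) (use permutes_in_image[OF p] in auto)
    also have "\<dots> = 2 * (\<Sum>i = 0..<k. \<alpha> i)"
      using sum.permute[OF p, of \<alpha>] by (simp add: sum.distrib o_def)
    finally have "degree (\<Prod>i = 0..<k. q i (p i)) \<le> 2 * (\<Sum>i<k. \<alpha> i)"
      by (simp add: lessThan_atLeast0)
    moreover have "degree (signof p * (\<Prod>i = 0..<k. q i (p i))) \<le> degree (\<Prod>i = 0..<k. q i (p i))"
      by (rule order_trans[OF degree_mult_le]) (simp add: sign_def)
    ultimately show "degree (signof p * (\<Prod>i = 0..<k. q i (p i))) \<le> 2 * (\<Sum>i<k. \<alpha> i)"
      by linarith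
  qed (simp add: finite_permutations)
qed

lemma cm_det_line_poly:
  fixes x y :: "nat set \<Rightarrow> complex"
  obtains P where "degree P \<le> 2 * k" "\<And>t. poly P t = cm_det k (\<lambda>e. x e + t * y e)"
proof -
  define r where "r e = [:x e, y e:]\<^sup>2" for e
  have r: "degree (r e) \<le> 2" for e
    unfolding r_def by (rule order_trans[OF degree_power_le]) simp
  define q where "q i j = smult (1/2) (r {0, Suc i} + r {0, Suc j} -
    (if i = j then 0 else r {Suc i, Suc j}))" for i j
  have "degree (q i j) \<le> 1 + 1" for i j
    unfolding q_def by (intro order_trans[OF degree_smult_le] degree_diff_le degree_add_le)
      (use r in \<open>auto simp: numeral_2_eq_2\<close>)
  from det_poly_entries[of k q "\<lambda>_. 1", OF this] obtain P where P: "degree P \<le> 2 * (\<Sum>i<k. 1)"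
    "\<And>t. poly P t = det (mat k k (\<lambda>(i, j). poly (q i j) t))" by metis
  have "gram (\<lambda>e. (x e + t * y e)\<^sup>2) i j = poly (q i j) t" for t i j
    by (simp add: q_def r_def gram_def)
  with P that show ?thesis by (auto simp: cm_det_def)
qed

text \<open>Congruence by the unipotent matrix \<open>T\<close>: row 0 and then column 0 are
  subtracted from the others. On a Gram matrix this moves the base point from vertex 0 to vertex 1,
  so that vertex 0 enters only through row and column 0. Stars centred at vertex 0 are treated this
  way.\<close>

lemma det_mat_subtract_first:
  fixes g :: "nat \<Rightarrow> nat \<Rightarrow> 'a::comm_ring_1"
  assumes "k > 0"
  shows "det (mat k k (\<lambda>(i, j). g i j)) = det (mat k k (\<lambda>(i, j).
    g i j - (if i = 0 then 0 else g 0 j) - (if j = 0 then 0 else g i 0 - (if i = 0 then 0 else g 0 0))))"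
proof -
  define T where "T = mat k k (\<lambda>(i, j). if i = j then 1 else if j = 0 then -1 else (0::'a))"
  define G where "G = mat k k (\<lambda>(i, j). g i j)"
  define G' where "G' = mat k k (\<lambda>(i, j). g i j - (if i = 0 then 0 else g 0 j))"
  have T: "T \<in> carrier_mat k k" and G: "G \<in> carrier_mat k k" and G': "G' \<in> carrier_mat k k"
    by (auto simp: T_def G_def G'_def)
  have sumT: "(\<Sum>l = 0..<k. (if i = l then 1 else if l = 0 then -1 else 0) * h l) =
      h i - (if i = 0 then 0 else h 0)" if "i < k" for i and h :: "nat \<Rightarrow> 'a"
  proof -
    have "(\<Sum>l = 0..<k. (if i = l then 1 else if l = 0 then -1 else 0) * h l) =
      (\<Sum>l = 0..<k. (if l = i then h l else 0) - (if l = 0 then (if i = 0 then 0 else h 0) else 0))"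
      by (rule sum.cong) auto
    also have "\<dots> = h i - (if i = 0 then 0 else h 0)"
      using that by (simp add: sum_subtractf)
    finally show ?thesis .
  qed
  have TG: "T * G = G'"
    by (rule eq_matI) (auto simp: T_def G_def G'_def scalar_prod_def sumT)
  have "G' * transpose_mat T = mat k k (\<lambda>(i, j).
    g i j - (if i = 0 then 0 else g 0 j) - (if j = 0 then 0 else g i 0 - (if i = 0 then 0 else g 0 0)))"
    (is "_ = ?H")
  proof (rule eq_matI)
    fix i j assume "i < dim_row ?H" "j < dim_col ?H"
    then have ij: "i < k" "j < k" by auto
    have "(G' * transpose_mat T) $$ (i, j) =
        (\<Sum>l = 0..<k. (if j = l then 1 else if l = 0 then -1 else 0) * (g i l - (if i = 0 then 0 else g 0 l)))"
      using ij by (simp add: T_def G'_def scalar_prod_def mult.commute)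
    then show "(G' * transpose_mat T) $$ (i, j) = ?H $$ (i, j)"
      using ij by (subst (asm) sumT) auto
  qed (auto simp: T_def G'_def)
  moreover have "det T = 1"
  proof -
    have "det T = prod_list (diag_mat T)"
      by (rule det_lower_triangular[OF _ T]) (auto simp: T_def)
    also have "diag_mat T = map (\<lambda>_. 1) [0..<k]"
      by (auto simp: diag_mat_def T_def)
    finally show ?thesis by (simp add: map_replicate_const)
  qed
  moreover have "det (G' * transpose_mat T) = det T * det G * det T"
    using T G G' by (simp add: TG[symmetric] det_mult[of _ k] det_transpose[of _ k])
  ultimately show ?thesis by (simp add: G_def)
qed

section \<open>The Gram determinant as equation of the variety\<close>

lemma doubleton_in_edges: "{a, b} \<in> edges n \<longleftrightarrow> a < n \<and> b < n \<and> a \<noteq> b"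
  by (auto simp: edges_def card_insert_if)

lemma edgesE:
  assumes "e \<in> edges n"
  obtains a b where "e = {a, b}" "a < b" "b < n"
proof -
  from assms obtain a b where ab: "e = {a, b}" "a \<noteq> b" "e \<subseteq> {..<n}"
    by (auto simp: edges_def card_2_iff)
  show ?thesis
  proof (cases "a < b")
    case True with ab that show ?thesis by auto
  next
    case False with ab that[of b a] show ?thesis by (auto simp: insert_commute)
  qed
qed

lemma edge_at:
  assumes "e \<in> edges n" "a \<in> e"
  obtains b where "e = {a, b}" "b \<noteq> a" "b < n" "a < n"
proof -
  from assms(1) obtain x y where "e = {x, y}" "x < y" "y < n" by (rule edgesE)
  with assms(2) that[of x] that[of y] show ?thesis by (auto simp: insert_commute)
qed

lemma finite_edges: "finite (edges n)"
  by (rule finite_subset[of _ "Pow {..<n}"]) (auto simp: edges_def)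

lemma meas_doubleton:
  assumes "a < d + 2" "b < d + 2" "a \<noteq> b"
  shows "meas d p {a, b} = (\<Sum>k<d. (p a k - p b k)\<^sup>2)"
proof -
  have "(p (min a b) k - p (max a b) k)\<^sup>2 = (p a k - p b k)\<^sup>2" for k
    by (cases "a \<le> b") (simp_all add: power2_commute min_def max_def)
  then show ?thesis
    using assms by (simp add: meas_def doubleton_in_edges)
qed

text \<open>Lagrange's reduction of a quadratic form: each step splits off one square through a
  Schur complement, and complex square roots absorb the pivots. One index is removed per column, so
  \<open>card I\<close> columns suffice.\<close>

lemma complex_symmetric_factorization:
  fixes B :: "'a \<Rightarrow> 'a \<Rightarrow> complex"
  assumes "finite I" and "\<And>i j. i \<in> I \<Longrightarrow> j \<in> I \<Longrightarrow> B i j = B j i"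
  shows "\<exists>X. \<forall>i\<in>I. \<forall>j\<in>I. B i j = (\<Sum>k<card I. X i k * X j k)"
  using assms
proof (induction "card I" arbitrary: I B)
  case 0
  then show ?case by auto
next
  case (Suc c)
  have pivot: "\<exists>X. \<forall>i\<in>I. \<forall>j\<in>I. C i j = (\<Sum>k<card I. X i k * X j k)"
    if sym: "\<And>i j. i \<in> I \<Longrightarrow> j \<in> I \<Longrightarrow> C i j = C j i" and r: "r \<in> I" "C r r \<noteq> 0"
    for C :: "'a \<Rightarrow> 'a \<Rightarrow> complex" and r
  proof -
    define s where "s = csqrt (C r r)"
    have s: "s * s = C r r" "s \<noteq> 0"
      using r by (auto simp: s_def simp flip: power2_eq_square)
    define C' where "C' i j = C i j - C i r * C j r / C r r" for i j
    have c: "c = card (I - {r})" using Suc.hyps(2) r Suc.prems(1) by simp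
    have "\<exists>X. \<forall>i\<in>I - {r}. \<forall>j\<in>I - {r}. C' i j = (\<Sum>k<card (I - {r}). X i k * X j k)"
      by (rule Suc.hyps(1)[OF c]) (use Suc.prems(1) sym in \<open>auto simp: C'_def mult.commute\<close>)
    then obtain X where X: "\<And>i j. i \<in> I - {r} \<Longrightarrow> j \<in> I - {r} \<Longrightarrow> C' i j = (\<Sum>k<c. X i k * X j k)"
      unfolding c by blast
    define Y where "Y i k = (if k = c then C i r / s else if i = r then 0 else X i k)" for i k
    have "C i j = (\<Sum>k<card I. Y i k * Y j k)" if ij: "i \<in> I" "j \<in> I" for i j
    proof -
      have "(\<Sum>k<c. Y i k * Y j k) = C' i j"
      proof (cases "i = r \<or> j = r")
        case True
        then have "C' i j = 0" using sym[of r j] r ij by (auto simp: C'_def)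
        moreover have "(\<Sum>k<c. Y i k * Y j k) = 0"
          using True by (intro sum.neutral) (auto simp: Y_def)
        ultimately show ?thesis by simp
      next
        case False
        then show ?thesis using ij by (simp add: X Y_def)
      qed
      moreover have "Y i c * Y j c = C i r * C j r / C r r"
        using s by (simp add: Y_def flip: s(1))
      ultimately show ?thesis
        unfolding Suc.hyps(2)[symmetric] by (simp add: C'_def)
    qed
    then show ?thesis by blast
  qed
  consider (zero) "\<forall>i\<in>I. \<forall>j\<in>I. B i j = 0" | (diag) r where "r \<in> I" "B r r \<noteq> 0"
    | (off) r s where "r \<in> I" "s \<in> I" "B r s \<noteq> 0" "\<forall>i\<in>I. B i i = 0"
    by blast
  then show ?case
  proof cases
    case zero
    then show ?thesis by (intro exI[of _ "\<lambda>_ _. 0"]) auto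
  next
    case diag
    then show ?thesis using pivot[of B r] Suc.prems(2) by blast
  next
    case off
    then have rs: "r \<noteq> s" by auto
    \<comment> \<open>With a zero diagonal there is no pivot. Replacing basis vector
      \<open>r\<close> by the sum of \<open>r\<close> and \<open>s\<close> makes the entry at
      \<open>(r, r)\<close> equal to \<open>2 * B r s\<close>; \<open>Y\<close> below reverts the
      change.\<close>
    define C where "C i j = B i j + (if i = r then B s j else 0) + (if j = r then B i s else 0)
      + (if i = r \<and> j = r then B s s else 0)" for i j
    have "\<exists>X. \<forall>i\<in>I. \<forall>j\<in>I. C i j = (\<Sum>k<card I. X i k * X j k)"
      by (rule pivot[of C r]) (use off Suc.prems(2) in \<open>auto simp: C_def\<close>)
    then obtain X where X: "\<And>i j. i \<in> I \<Longrightarrow> j \<in> I \<Longrightarrow> C i j = (\<Sum>k<card I. X i k * X j k)"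
      by blast
    define Y where "Y i k = X i k - (if i = r then X s k else 0)" for i k
    have "B i j = (\<Sum>k<card I. Y i k * Y j k)" if ij: "i \<in> I" "j \<in> I" for i j
    proof -
      have "(\<Sum>k<card I. Y i k * Y j k) = C i j - (if i = r then C s j else 0)
          - (if j = r then C i s else 0) + (if i = r \<and> j = r then C s s else 0)"
        using ij off by (simp add: X Y_def algebra_simps sum.distrib sum_subtractf)
      also have "\<dots> = B i j"
        using rs by (auto simp: C_def)
      finally show ?thesis by simp
    qed
    then show ?thesis by blast
  qed
qed

text \<open>A kernel vector \<open>z\<close> with \<open>z $ r \<noteq> 0\<close> makes row
  \<open>r\<close> a combination of the other rows. The block without \<open>r\<close> factors
  through \<open>d\<close> columns, and the same combination of its factor rows supplies row
  \<open>r\<close>. The saved column places the points in dimension \<open>d\<close>.\<close>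

lemma complex_symmetric_singular_factorization:
  fixes B :: "nat \<Rightarrow> nat \<Rightarrow> complex"
  assumes sym: "\<And>i j. B i j = B j i" and sing: "det (mat (Suc d) (Suc d) (\<lambda>(i, j). B i j)) = 0"
  obtains X where "\<And>i j. i < Suc d \<Longrightarrow> j < Suc d \<Longrightarrow> B i j = (\<Sum>k<d. X i k * X j k)"
proof -
  obtain z where z: "z \<in> carrier_vec (Suc d)" "z \<noteq> 0\<^sub>v (Suc d)"
    "mat (Suc d) (Suc d) (\<lambda>(i, j). B i j) *\<^sub>v z = 0\<^sub>v (Suc d)"
    using sing by (subst (asm) det_0_iff_vec_prod_zero[where n = "Suc d"]) auto
  have ker: "(\<Sum>j<Suc d. B i j * z $ j) = 0" if "i < Suc d" for i
  proof -
    have "(mat (Suc d) (Suc d) (\<lambda>(i, j). B i j) *\<^sub>v z) $ i = 0"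
      using that z(3) by simp
    then show ?thesis
      using that z(1) by (simp add: scalar_prod_def lessThan_atLeast0 del: sum.op_ivl_Suc sum.lessThan_Suc)
  qed
  obtain r where r: "r < Suc d" "z $ r \<noteq> 0"
    using z(1,2) by (metis carrier_vecD eq_vecI index_zero_vec(1) index_zero_vec(2))
  define I where "I = {..<Suc d} - {r}"
  have I: "finite I" "card I = d" "{..<Suc d} = insert r I" "r \<notin> I" using r by (auto simp: I_def)
  obtain X where X: "\<And>i j. i \<in> I \<Longrightarrow> j \<in> I \<Longrightarrow> B i j = (\<Sum>k<d. X i k * X j k)"
    using complex_symmetric_factorization[of I B] I sym by metis
  have row: "B i r = (\<Sum>j\<in>I. (- z $ j / z $ r) * B i j)" if "i < Suc d" for i
  proof -
    have "B i r * z $ r + (\<Sum>j\<in>I. B i j * z $ j) = 0"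
      using ker[OF that] I by simp
    then have "B i r * z $ r = - (\<Sum>j\<in>I. B i j * z $ j)"
      by (simp add: add_eq_0_iff2)
    then have "B i r = - (\<Sum>j\<in>I. B i j * z $ j) / z $ r"
      using r by (simp add: field_simps)
    then show ?thesis
      by (simp add: sum_divide_distrib sum_negf mult.commute)
  qed
  define Y where "Y i k = (if i = r then \<Sum>j\<in>I. (- z $ j / z $ r) * X j k else X i k)" for i k
  have Y1: "B i j = (\<Sum>k<d. Y i k * Y j k)" if "i \<in> I" "j \<in> I" for i j
    using that X[OF that] I(4) by (auto simp: Y_def intro!: sum.cong)
  have Y2: "B i r = (\<Sum>k<d. Y i k * Y r k)" if i: "i < Suc d" "\<And>j. j \<in> I \<Longrightarrow> B i j = (\<Sum>k<d. Y i k * Y j k)" for i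
  proof -
    have "B i r = (\<Sum>j\<in>I. (- z $ j / z $ r) * (\<Sum>k<d. Y i k * Y j k))"
      unfolding row[OF i(1)] using i(2) by simp
    also have "\<dots> = (\<Sum>k<d. \<Sum>j\<in>I. (- z $ j / z $ r) * (Y i k * Y j k))"
      unfolding sum_distrib_left by (rule sum.swap)
    also have "\<dots> = (\<Sum>k<d. Y i k * Y r k)"
    proof (rule sum.cong[OF refl])
      fix k
      have "Y r k = (\<Sum>j\<in>I. (- z $ j / z $ r) * Y j k)"
        using I(4) by (auto simp: Y_def intro!: sum.cong)
      then show "(\<Sum>j\<in>I. (- z $ j / z $ r) * (Y i k * Y j k)) = Y i k * Y r k"
        by (simp only: sum_distrib_left) (simp add: mult.left_commute)
    qed
    finally show ?thesis .
  qed
  have Y3: "B i r = (\<Sum>k<d. Y i k * Y r k)" if "i \<in> I" for i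
    using that Y1 I(3) by (intro Y2) auto
  have Y4: "B r j = (\<Sum>k<d. Y r k * Y j k)" if "j \<in> I" for j
    using Y3[OF that] sym[of r j] by (simp add: mult.commute)
  have Y5: "B r r = (\<Sum>k<d. Y r k * Y r k)"
    using r Y4 by (intro Y2) auto
  have "B i j = (\<Sum>k<d. Y i k * Y j k)" if "i < Suc d" "j < Suc d" for i j
  proof -
    have "i \<in> insert r I" "j \<in> insert r I" using that I(3) by auto
    then show ?thesis using Y1 Y3 Y4 Y5 by blast
  qed
  then show ?thesis using that by blast
qed

lemma gram_commute: "gram m i j = gram m j i"
  by (simp add: gram_def insert_commute)

lemma L_var_iff_cm_det:
  assumes v: "v \<in> edge_space (d + 2)"
  shows "v \<in> L_var d \<longleftrightarrow> cm_det (d + 1) v = 0"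
proof
  assume "v \<in> L_var d"
  then obtain p where p: "(\<lambda>e. (v e)\<^sup>2) = meas d p"
    by (auto simp: L_var_def M_var_def)
  \<comment> \<open>The coordinates relative to vertex 0 form a \<open>Suc d\<close> by
    \<open>d\<close> matrix; the zero column \<open>d\<close> makes it square and singular.\<close>
  define X where "X i k = (if k < d then p (Suc i) k - p 0 k else 0)" for i k
  define XM where "XM = mat (Suc d) (Suc d) (\<lambda>(i, j). X i j)"
  have XM: "XM \<in> carrier_mat (Suc d) (Suc d)" by (simp add: XM_def)
  have "gram (meas d p) i j = (\<Sum>k<d. X i k * X j k)" if "i < Suc d" "j < Suc d" for i j
  proof -
    have "gram (meas d p) i j = ((\<Sum>k<d. (p 0 k - p (Suc i) k)\<^sup>2) + (\<Sum>k<d. (p 0 k - p (Suc j) k)\<^sup>2)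
        - (\<Sum>k<d. (p (Suc i) k - p (Suc j) k)\<^sup>2)) / 2"
      using that by (simp add: gram_def meas_doubleton)
    also have "\<dots> = (\<Sum>k<d. X i k * X j k)"
      unfolding sum.distrib[symmetric] sum_subtractf[symmetric] sum_divide_distrib
      by (rule sum.cong) (auto simp: X_def power2_eq_square field_simps)
    finally show ?thesis .
  qed
  then have "mat (d + 1) (d + 1) (\<lambda>(i, j). gram (\<lambda>e. (v e)\<^sup>2) i j) = XM * transpose_mat XM"
    unfolding p by (intro eq_matI) (auto simp: XM_def scalar_prod_def lessThan_atLeast0 X_def)
  moreover have "det XM = 0"
  proof -
    have "det XM = det (transpose_mat XM)" using XM by (simp add: det_transpose)
    also have "\<dots> = det (mat (Suc d) (Suc d) (\<lambda>(i, j). X j i))"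
      by (rule arg_cong[of _ _ det]) (auto simp: XM_def)
    also have "\<dots> = 0"
      unfolding det_mat_leibniz
      by (rule sum.neutral) (auto simp: X_def)
    finally show ?thesis .
  qed
  ultimately show "cm_det (d + 1) v = 0"
    using XM by (simp add: cm_det_def det_mult[of _ "Suc d"])
next
  assume "cm_det (d + 1) v = 0"
  then obtain X where X: "\<And>i j. i < Suc d \<Longrightarrow> j < Suc d \<Longrightarrow> gram (\<lambda>e. (v e)\<^sup>2) i j = (\<Sum>k<d. X i k * X j k)"
    using complex_symmetric_singular_factorization[of "gram (\<lambda>e. (v e)\<^sup>2)" d] gram_commute[of "\<lambda>e. (v e)\<^sup>2"]
    by (auto simp: cm_det_def)
  \<comment> \<open>Vertex 0 sits at the origin, so the factor rows are the remaining
    points.\<close>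
  define p where "p i k = (case i of 0 \<Rightarrow> 0 | Suc i \<Rightarrow> X i k)" for i k
  have "(v e)\<^sup>2 = meas d p e" for e
  proof (cases "e \<in> edges (d + 2)")
    case False
    then show ?thesis using v by (auto simp: meas_def edge_space_def)
  next
    case True
    then obtain a b where ab: "e = {a, b}" "a < b" "b < d + 2" by (rule edgesE)
    then obtain b' where b': "b = Suc b'" by (cases b) auto
    show ?thesis
    proof (cases a)
      case 0
      then show ?thesis
        using ab b' X[of b' b'] by (simp add: meas_doubleton p_def gram_def power2_eq_square)
    next
      case (Suc a')
      have "meas d p e = (\<Sum>k<d. X a' k * X a' k) + (\<Sum>k<d. X b' k * X b' k) - 2 * (\<Sum>k<d. X a' k * X b' k)"
        unfolding sum_distrib_left sum.distrib[symmetric] sum_subtractf[symmetric]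
        using ab b' Suc by (simp add: meas_doubleton p_def power2_eq_square algebra_simps)
      also have "\<dots> = gram (\<lambda>e. (v e)\<^sup>2) a' a' + gram (\<lambda>e. (v e)\<^sup>2) b' b' - 2 * gram (\<lambda>e. (v e)\<^sup>2) a' b'"
        using ab b' Suc by (simp add: X)
      also have "\<dots> = (v e)\<^sup>2"
        using ab b' Suc by (simp add: gram_def field_simps)
      finally show ?thesis by simp
    qed
  qed
  then have "(\<lambda>e. (v e)\<^sup>2) = meas d p" by auto
  then show "v \<in> L_var d" using v by (auto simp: L_var_def M_var_def)
qed

section \<open>A line with the maximal number of real intersections\<close>

definition principal_minor :: "nat set \<Rightarrow> (nat \<Rightarrow> nat \<Rightarrow> 'a::comm_ring_1) \<Rightarrow> 'a" where
  "principal_minor W g = (\<Sum>p | p permutes W. signof p * (\<Prod>i\<in>W. g i (p i)))"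

lemma det_mat_principal_minor:
  "det (mat k k (\<lambda>(i, j). g i j)) = principal_minor {0..<k} g"
  by (simp add: det_mat_leibniz principal_minor_def)

lemma principal_minor_2:
  assumes "i \<noteq> j"
  shows "principal_minor {i, j} g = g i i * g j j - g i j * g j i"
proof -
  have f: "finite {j}" "i \<notin> {j}" using assms by auto
  show ?thesis
    unfolding principal_minor_def sum_over_permutations_insert[OF f] permutes_sing
    using assms by (simp add: sign_swap_id permutation_swap_id sign_compose sign_id transpose_def)
qed

lemma principal_minor_3:
  assumes "i \<noteq> j" "i \<noteq> k" "j \<noteq> k"
  shows "principal_minor {i, j, k} g = g i i * g j j * g k k + g i j * g j k * g k i
    + g i k * g j i * g k j - g i i * g j k * g k j - g i j * g j i * g k k - g i k * g j j * g k i"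
proof -
  have f: "finite {j, k}" "i \<notin> {j, k}" "finite {k}" "j \<notin> {k}" using assms by auto
  show ?thesis
    unfolding principal_minor_def sum_over_permutations_insert[OF f(1,2)]
      sum_over_permutations_insert[OF f(3,4)] permutes_sing
    using assms
    by (simp add: sign_swap_id permutation_swap_id permutation_compose sign_compose sign_id transpose_def algebra_simps)
qed

text \<open>Subtracting row \<open>k\<close> and column \<open>k\<close> from the last ones leaves
  the last row \<open>0, ..., 0, -u, g (Suc k) (Suc k)\<close>: the corner changes by
  \<open>- u - u + 2 * u = 0\<close>. Expansion along that row gives the recursion.\<close>

lemma det_two_step:
  fixes g :: "nat \<Rightarrow> nat \<Rightarrow> 'a::field"
  assumes row: "\<And>i. i < k \<Longrightarrow> g (Suc k) i = g k i"
    and col: "\<And>i. i < k \<Longrightarrow> g i (Suc k) = g i k"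
    and "g k k = 2 * u" "g (Suc k) k = u" "g k (Suc k) = u"
  shows "det (mat (Suc (Suc k)) (Suc (Suc k)) (\<lambda>(i, j). g i j)) =
    g (Suc k) (Suc k) * det (mat (Suc k) (Suc k) (\<lambda>(i, j). g i j)) - u\<^sup>2 * det (mat k k (\<lambda>(i, j). g i j))"
proof -
  define n where "n = Suc (Suc k)"
  define G where "G = mat n n (\<lambda>(i, j). g i j)"
  define H where "H = mat n n (\<lambda>(i, j). if i = Suc k then (if j = Suc k then g i j else if j = k then -u else 0)
    else if j = Suc k then (if i = k then -u else 0) else g i j)"
  have G: "G \<in> carrier_mat n n" and H: "H \<in> carrier_mat n n" by (auto simp: G_def H_def)
  have "H = addcol (-1) (Suc k) k (addrow (-1) (Suc k) k G)"
    by (rule eq_matI) (auto simp: G_def H_def n_def assms less_Suc_eq)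
  moreover have "det (addcol (-1) (Suc k) k (addrow (-1) (Suc k) k G)) = det G"
    using G by (subst det_addcol[where n = n]) (auto simp: n_def det_addrow[where n = n])
  ultimately have "det G = det H" by simp
  also have "\<dots> = (\<Sum>j<n. H $$ (Suc k, j) * cofactor H (Suc k) j)"
    by (rule laplace_expansion_row[OF H]) (simp add: n_def)
  also have "\<dots> = H $$ (Suc k, k) * cofactor H (Suc k) k + H $$ (Suc k, Suc k) * cofactor H (Suc k) (Suc k)"
  proof -
    have "(\<Sum>j<k. H $$ (Suc k, j) * cofactor H (Suc k) j) = 0"
      by (rule sum.neutral) (auto simp: H_def n_def)
    then show ?thesis by (simp add: n_def)
  qed
  also have "H $$ (Suc k, k) = -u" by (simp add: H_def n_def)
  also have "H $$ (Suc k, Suc k) = g (Suc k) (Suc k)" by (simp add: H_def n_def)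
  also have "cofactor H (Suc k) (Suc k) = det (mat (Suc k) (Suc k) (\<lambda>(i, j). g i j))"
  proof -
    have "mat_delete H (Suc k) (Suc k) = mat (Suc k) (Suc k) (\<lambda>(i, j). g i j)"
      by (rule eq_matI) (auto simp: mat_delete_def H_def n_def)
    then show ?thesis by (simp add: cofactor_def)
  qed
  also have "cofactor H (Suc k) k = u * det (mat k k (\<lambda>(i, j). g i j))"
  proof -
    define K where "K = mat_delete H (Suc k) k"
    have K: "K \<in> carrier_mat (Suc k) (Suc k)" using H by (auto simp: K_def n_def intro: mat_delete_carrier)
    have Ke: "K $$ (i, k) = (if i = k then -u else 0)" if "i < Suc k" for i
      using that by (auto simp: K_def mat_delete_def H_def n_def)
    have "det K = (\<Sum>i<Suc k. K $$ (i, k) * cofactor K i k)"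
      by (rule laplace_expansion_column[OF K]) simp
    also have "\<dots> = - u * cofactor K k k"
    proof -
      have "(\<Sum>i<k. K $$ (i, k) * cofactor K i k) = 0"
        by (rule sum.neutral) (auto simp: Ke)
      then show ?thesis by (simp add: Ke)
    qed
    also have "cofactor K k k = det (mat k k (\<lambda>(i, j). g i j))"
    proof -
      have "mat_delete K k k = mat k k (\<lambda>(i, j). g i j)"
        using K by (intro eq_matI) (auto simp: mat_delete_def K_def H_def n_def)
      then show ?thesis by (simp add: cofactor_def)
    qed
    finally show ?thesis by (simp add: cofactor_def K_def)
  qed
  finally show ?thesis by (simp add: G_def n_def power2_eq_square)
qed

definition extend_by :: "nat \<Rightarrow> (nat set \<Rightarrow> 'a::zero) \<Rightarrow> 'a \<Rightarrow> nat set \<Rightarrow> 'a" where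
  "extend_by k v l e = (if k \<in> e then (if e \<in> edges (Suc k) then l else 0) else v e)"

lemma extend_by_doubleton:
  "a < k \<Longrightarrow> extend_by k v l {a, k} = l" "a < k \<Longrightarrow> extend_by k v l {k, a} = l"
  "a \<noteq> k \<Longrightarrow> b \<noteq> k \<Longrightarrow> extend_by k v l {a, b} = v {a, b}"
  by (auto simp: extend_by_def doubleton_in_edges)

lemma cm_det_extend_by: "cm_det k (extend_by (Suc k) v l) = cm_det k v"
  unfolding cm_det_def by (rule det_mat_cong) (auto simp: gram_def extend_by_doubleton)

text \<open>The inner product of an equidistant vertex with \<open>Suc i\<close> is half the squared
  length of \<open>{0, Suc i}\<close>, whatever the distance. So the two new rows agree on the old
  columns, and \<open>det_two_step\<close> applies with \<open>u = l\<^sup>2 / 2\<close>.\<close>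

lemma cm_det_extend_by_twice:
  fixes v :: "nat set \<Rightarrow> 'a::field_char_0"
  shows "cm_det (Suc (Suc k)) (extend_by (Suc (Suc k)) (extend_by (Suc k) v l) l') =
    l'\<^sup>2 * cm_det (Suc k) (extend_by (Suc k) v l) - (l\<^sup>2 / 2)\<^sup>2 * cm_det k v"
proof -
  let ?w = "extend_by (Suc (Suc k)) (extend_by (Suc k) v l) l'"
  let ?g = "gram (\<lambda>e. (?w e)\<^sup>2)"
  have "cm_det (Suc (Suc k)) ?w = ?g (Suc k) (Suc k) * cm_det (Suc k) ?w - (l\<^sup>2 / 2)\<^sup>2 * cm_det k ?w"
    unfolding cm_det_def
    by (rule det_two_step) (auto simp: gram_def extend_by_doubleton)
  moreover have "?g (Suc k) (Suc k) = l'\<^sup>2" by (simp add: gram_def extend_by_doubleton)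
  moreover have "cm_det (Suc k) ?w = cm_det (Suc k) (extend_by (Suc k) v l)"
    by (rule cm_det_extend_by)
  moreover have "cm_det k ?w = cm_det k v"
    unfolding cm_det_def by (rule det_mat_cong) (auto simp: gram_def extend_by_doubleton)
  ultimately show ?thesis by simp
qed

text \<open>Heron's formula: the Gram determinant of a triangle is four times its squared area. The
  linear factors provide the real roots of the base case.\<close>

lemma cm_det_2:
  fixes v :: "nat set \<Rightarrow> 'a::field_char_0"
  assumes "v {0, 1} = x" "v {0, 2} = y" "v {1, 2} = z"
  shows "cm_det 2 v = (x + y + z) * (x + y - z) * (x - y + z) * (y + z - x) / 4"
proof -
  have "{0..<2} = {0, 1::nat}" by auto
  then have "cm_det 2 v = gram (\<lambda>e. (v e)\<^sup>2) 0 0 * gram (\<lambda>e. (v e)\<^sup>2) 1 1 - gram (\<lambda>e. (v e)\<^sup>2) 0 1 * gram (\<lambda>e. (v e)\<^sup>2) 1 0"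
    by (simp add: cm_det_def det_mat_principal_minor principal_minor_2)
  also have "\<dots> = x\<^sup>2 * y\<^sup>2 - ((x\<^sup>2 + y\<^sup>2 - z\<^sup>2) / 2)\<^sup>2"
    using assms by (simp add: gram_def insert_commute numeral_2_eq_2 field_simps power2_eq_square)
  finally show ?thesis by (simp add: field_simps power2_eq_square)
qed

text \<open>For a nondegenerate triangle the equidistant apex lies over the circumcentre, so the
  value is \<open>cm_det 2 v\<close> times \<open>l\<^sup>2 - R\<^sup>2\<close>, where the
  circumradius \<open>R\<close> is \<open>x y z / (4 area)\<close>.\<close>

lemma cm_det_3_extend_by:
  fixes v :: "nat set \<Rightarrow> 'a::field_char_0"
  assumes "v {0, 1} = x" "v {0, 2} = y" "v {1, 2} = z"
  shows "cm_det 3 (extend_by 3 v l) = l\<^sup>2 * cm_det 2 v - (x * y * z)\<^sup>2 / 4"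
proof -
  have "{0..<3} = {0, 1, 2::nat}" by auto
  then have "cm_det 3 (extend_by 3 v l) = principal_minor {0, 1, 2} (gram (\<lambda>e. (extend_by 3 v l e)\<^sup>2))"
    by (simp add: cm_det_def det_mat_principal_minor)
  also have "\<dots> = l\<^sup>2 * ((x + y + z) * (x + y - z) * (x - y + z) * (y + z - x) / 4) - (x * y * z)\<^sup>2 / 4"
  proof -
    let ?g = "gram (\<lambda>e. (extend_by 3 v l e)\<^sup>2)"
    have *: "Suc 2 = 3" "Suc 1 = 2" by auto
    have g: "?g 0 0 = x\<^sup>2" "?g 1 1 = y\<^sup>2" "?g 2 2 = l\<^sup>2" "?g 0 1 = (x\<^sup>2 + y\<^sup>2 - z\<^sup>2) / 2"
       "?g 1 0 = (x\<^sup>2 + y\<^sup>2 - z\<^sup>2) / 2" "?g 0 2 = x\<^sup>2 / 2" "?g 2 0 = x\<^sup>2 / 2" "?g 1 2 = y\<^sup>2 / 2" "?g 2 1 = y\<^sup>2 / 2"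
      using assms by (simp_all add: gram_def extend_by_doubleton insert_commute * One_nat_def[symmetric] del: One_nat_def)
    show ?thesis
      by (subst principal_minor_3) (simp_all only: g, simp_all add: field_simps power2_eq_square)
  qed
  finally show ?thesis using cm_det_2[of v x y z] assms by simp
qed

section \<open>Sign changes along a real line\<close>

lemma continuous_cm_det:
  fixes v :: "'b::topological_space \<Rightarrow> nat set \<Rightarrow> 'a::real_normed_field"
  assumes "\<And>e. continuous_on S (\<lambda>s. v s e)"
  shows "continuous_on S (\<lambda>s. cm_det k (v s))"
proof -
  have "continuous_on S (\<lambda>s. gram (\<lambda>e. (v s e)\<^sup>2) i j)" for i j
    by (cases "i = j") (auto simp: gram_def intro!: continuous_intros assms)
  then show ?thesis
    unfolding cm_det_def det_mat_leibniz by (intro continuous_intros)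
qed

lemma cm_det_of_real:
  "cm_det k (\<lambda>e. complex_of_real (v e)) = complex_of_real (cm_det k v)"
proof -
  have "gram (\<lambda>e. (complex_of_real (v e))\<^sup>2) i j = of_real (gram (\<lambda>e. (v e)\<^sup>2) i j)" for i j
    by (simp add: gram_def)
  then show ?thesis by (simp add: cm_det_def det_mat_leibniz)
qed

lemma edges_mono: "n \<le> m \<Longrightarrow> edges n \<subseteq> edges m"
  by (auto simp: edges_def)

text \<open>
  Attaching a vertex at the same distance \<open>l\<close> from all others turns \<open>f\<close> into \<open>l\<^sup>2 f + h\<close>. With
  \<open>l = M (t - c)\<close> and \<open>M\<close> large the old sign changes persist, while at \<open>t = c\<close> the value is
  \<open>h c\<close>, of the sign opposite to \<open>f\<close>, which produces two new ones.
\<close>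
lemma alternating_line_step:
  fixes f h :: "real \<Rightarrow> real"
  assumes cont: "continuous_on UNIV f" "continuous_on UNIV h"
    and alt: "\<And>i. i < K \<Longrightarrow> t i < t (Suc i) \<and> f (t i) * f (t (Suc i)) < 0"
    and last: "f (t K) * h (t K) < 0"
  shows "\<exists>M c t'. (\<forall>i<Suc (Suc K). t' i < t' (Suc i) \<and>
       ((M * (t' i - c))\<^sup>2 * f (t' i) + h (t' i)) * ((M * (t' (Suc i) - c))\<^sup>2 * f (t' (Suc i)) + h (t' (Suc i))) < 0) \<and>
     ((M * (t' (Suc (Suc K)) - c))\<^sup>2 * f (t' (Suc (Suc K))) + h (t' (Suc (Suc K))))
        * (- ((M * (t' (Suc (Suc K)) - c))\<^sup>2 / 2)\<^sup>2 * f (t' (Suc (Suc K)))) < 0"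
proof -
  let ?T = "t K"
  have "(f \<longlongrightarrow> f ?T) (nhds ?T)" "(h \<longlongrightarrow> h ?T) (nhds ?T)"
    using cont by (simp_all add: continuous_on_eq_continuous_at isCont_def tendsto_at_iff_tendsto_nhds)
  then have lim: "((\<lambda>s. f s * h s) \<longlongrightarrow> f ?T * h ?T) (nhds ?T)"
    "((\<lambda>s. f s * f ?T) \<longlongrightarrow> f ?T * f ?T) (nhds ?T)"
    by (auto intro!: tendsto_intros)
  have "f ?T * f ?T > 0" using last by (auto simp: zero_less_mult_iff mult_less_0_iff)
  with lim last have "\<forall>\<^sub>F s in nhds ?T. f s * h s < 0" "\<forall>\<^sub>F s in nhds ?T. f s * f ?T > 0"
    using order_tendstoD by blast+
  then have "\<forall>\<^sub>F s in nhds ?T. f s * h s < 0 \<and> f s * f ?T > 0"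
    by (rule eventually_conj)
  then obtain e where e: "e > 0" "\<And>s. \<bar>s - ?T\<bar> < e \<Longrightarrow> f s * h s < 0 \<and> f s * f ?T > 0"
    by (auto simp: eventually_nhds_metric dist_real_def)
  \<comment> \<open>Beyond the last sample point \<open>f\<close> keeps its sign at \<open>c\<close>
    and \<open>c'\<close>, and \<open>h\<close> has the opposite one. At \<open>c\<close> the new
    edge length vanishes and only \<open>h\<close> is left; at \<open>c'\<close>, as at the old
    points, the term with \<open>M\<close> prevails.\<close>
  define c where "c = ?T + e / 3"
  define c' where "c' = ?T + 2 * e / 3"
  have c: "?T < c" "c < c'" "f c * h c < 0" "f c * f ?T > 0" "f c' * h c' < 0" "f c' * f ?T > 0"
    using e by (auto simp: c_def c'_def)
  have le_T: "t i \<le> ?T" if "i \<le> K" for i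
    using that
  proof (induction rule: inc_induct)
    case (step n) then show ?case using alt[of n] by linarith
  qed simp
  have nz: "f (t i) \<noteq> 0" if "i \<le> K" for i
    using that alt[of i] last by (cases "i = K") auto
  define S where "S = insert c' (t ` {..K})"
  have "\<forall>\<^sub>F N in at_top. 0 < f s * (N * (s - c)\<^sup>2 * f s + h s)" if "s \<in> S" for s
  proof -
    have "f s \<noteq> 0" "s \<noteq> c"
      using that nz le_T c by (auto simp: S_def) fastforce
    then have pos: "0 < (s - c)\<^sup>2 * (f s)\<^sup>2" by simp
    have "\<forall>\<^sub>F N in at_top. - (f s * h s) / ((s - c)\<^sup>2 * (f s)\<^sup>2) < N"
      by (rule eventually_gt_at_top)
    then show ?thesis
    proof eventually_elim
      case (elim N)
      then have "- (f s * h s) < N * ((s - c)\<^sup>2 * (f s)\<^sup>2)"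
        by (simp only: pos_divide_less_eq[OF pos])
      then show ?case by (simp add: algebra_simps power2_eq_square)
    qed
  qed
  then have "\<forall>\<^sub>F N in at_top. \<forall>s\<in>S. 0 < f s * (N * (s - c)\<^sup>2 * f s + h s)"
    by (intro eventually_ball_finite) (auto simp: S_def)
  then have "\<forall>\<^sub>F N in at_top. (\<forall>s\<in>S. 0 < f s * (N * (s - c)\<^sup>2 * f s + h s)) \<and> 0 < N"
    by (rule eventually_conj[OF _ eventually_gt_at_top])
  then obtain N where N: "\<And>s. s \<in> S \<Longrightarrow> 0 < f s * (N * (s - c)\<^sup>2 * f s + h s)" "N > 0"
    by (metis (mono_tags, lifting) eventually_happens' trivial_limit_at_top_linorder)
  define M where "M = sqrt N"
  define g where "g s = (M * (s - c))\<^sup>2 * f s + h s" for s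
  have fg: "0 < f s * g s" if "s \<in> S" for s
    using N(1)[OF that] N(2) by (simp add: g_def M_def power_mult_distrib)
  define t' where "t' i = (if i \<le> K then t i else if i = Suc K then c else c')" for i
  have gc: "g c = h c" by (simp add: g_def)
  have "t' i < t' (Suc i) \<and> g (t' i) * g (t' (Suc i)) < 0" if i: "i < Suc (Suc K)" for i
  proof -
    consider "i < K" | "i = K" | "i = Suc K" using i by linarith
    then show ?thesis
    proof cases
      case 1
      then have "0 < f (t i) * g (t i)" "0 < f (t (Suc i)) * g (t (Suc i))"
        by (auto intro!: fg simp: S_def)
      with alt[OF 1] 1 show ?thesis
        by (auto simp: t'_def zero_less_mult_iff mult_less_0_iff)
    next
      case 2
      have "0 < f ?T * g ?T" by (rule fg) (simp add: S_def)
      with c 2 show ?thesis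
        by (auto simp: t'_def gc zero_less_mult_iff mult_less_0_iff)
    next
      case 3
      have "0 < f c' * g c'" by (rule fg) (simp add: S_def)
      with c 3 show ?thesis
        by (auto simp: t'_def gc zero_less_mult_iff mult_less_0_iff)
    qed
  qed
  moreover have "g c' * (- ((M * (c' - c))\<^sup>2 / 2)\<^sup>2 * f c') < 0"
  proof -
    have "0 < f c' * g c'" by (rule fg) (simp add: S_def)
    moreover have "0 < ((M * (c' - c))\<^sup>2 / 2)\<^sup>2"
      using c N(2) by (simp add: M_def)
    ultimately have "0 < ((M * (c' - c))\<^sup>2 / 2)\<^sup>2 * (f c' * g c')" by (rule mult_pos_pos[rotated])
    then show ?thesis by (simp add: mult_ac)
  qed
  moreover have "t' (Suc (Suc K)) = c'" by (simp add: t'_def)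
  ultimately show ?thesis
    unfolding g_def by (intro exI[of _ M] exI[of _ c] exI[of _ t']) simp
qed

text \<open>Sign changes alone do not carry the induction. The invariant also records the summand
  \<open>h\<close> that the next equidistant vertex will add, and that \<open>h\<close> opposes the
  determinant at the last sample point. In the step the next \<open>h\<close> is minus a square
  times the old determinant, by \<open>cm_det_extend_by_twice\<close>.\<close>

lemma alternating_line_aux:
  assumes "k \<ge> 2"
  shows "\<exists>(p :: nat set \<Rightarrow> real) q t h. (\<forall>e. e \<notin> edges (Suc k) \<longrightarrow> p e = 0 \<and> q e = 0) \<and> continuous_on UNIV h \<and>
    (\<forall>s l. cm_det (Suc k) (extend_by (Suc k) (\<lambda>e. p e + s * q e) l) = l\<^sup>2 * cm_det k (\<lambda>e. p e + s * q e) + h s) \<and>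
    (\<forall>i<2*k. t i < t (Suc i) \<and> cm_det k (\<lambda>e. p e + t i * q e) * cm_det k (\<lambda>e. p e + t (Suc i) * q e) < 0) \<and>
    cm_det k (\<lambda>e. p e + t (2*k) * q e) * h (t (2*k)) < 0"
  using assms
proof (induction k rule: dec_induct)
  case base
  \<comment> \<open>For a triangle with sides \<open>s\<close>, \<open>s + 1\<close>,
    \<open>s + 3\<close> Heron's factors have the distinct roots -4, -2, -4/3 and 2; the points in
    \<open>t\<close> interlace them.\<close>
  define p q :: "nat set \<Rightarrow> real" where
    "p e = (if e = {0, 2} then 1 else if e = {1, 2} then 3 else 0)" and
    "q e = (if e \<in> {{0, 1}, {0, 2}, {1, 2}} then 1 else 0)" for e
  define h :: "real \<Rightarrow> real" where "h s = - (s * (s + 1) * (s + 3))\<^sup>2 / 4" for s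
  define t :: "nat \<Rightarrow> real" where "t i = [-5, -3, -3/2, 0, 3] ! i" for i
  have ne: "{0, 1} \<noteq> {0, 2::nat}" "{0, 1} \<noteq> {1, 2::nat}" "{0, 2} \<noteq> {1, 2::nat}" by (auto simp: doubleton_eq_iff)
  have pq: "p {0, 1} + s * q {0, 1} = s" "p {0, 2} + s * q {0, 2} = s + 1" "p {1, 2} + s * q {1, 2} = s + 3" for s
    using ne by (auto simp: p_def q_def)
  have f: "cm_det 2 (\<lambda>e. p e + s * q e) = (3*s + 4) * (s - 2) * (s + 2) * (s + 4) / 4" for s
    by (subst cm_det_2[OF pq]) (simp add: field_simps)
  have "p e = 0 \<and> q e = 0" if "e \<notin> edges (Suc 2)" for e
    using that by (auto simp: p_def q_def doubleton_in_edges)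
  moreover have "continuous_on UNIV h" unfolding h_def by (intro continuous_intros) auto
  moreover have "cm_det (Suc 2) (extend_by (Suc 2) (\<lambda>e. p e + s * q e) l) = l\<^sup>2 * cm_det 2 (\<lambda>e. p e + s * q e) + h s" for s l
    using cm_det_3_extend_by[of "\<lambda>e. p e + s * q e", OF pq] by (simp add: h_def)
  moreover have "t i < t (Suc i) \<and> cm_det 2 (\<lambda>e. p e + t i * q e) * cm_det 2 (\<lambda>e. p e + t (Suc i) * q e) < 0"
    if "i < 2 * 2" for i
  proof -
    have "i = 0 \<or> i = 1 \<or> i = 2 \<or> i = 3" using that by linarith
    then show ?thesis unfolding f t_def by (elim disjE) simp_all
  qed
  moreover have "cm_det 2 (\<lambda>e. p e + t (2*2) * q e) * h (t (2*2)) < 0"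
    unfolding f h_def t_def by simp
  ultimately show ?case by blast
next
  case (step k)
  then obtain p q :: "nat set \<Rightarrow> real" and t h where
    supp: "\<And>e. e \<notin> edges (Suc k) \<Longrightarrow> p e = 0 \<and> q e = 0" and h: "continuous_on UNIV h" and
    ext: "\<And>s l. cm_det (Suc k) (extend_by (Suc k) (\<lambda>e. p e + s * q e) l) = l\<^sup>2 * cm_det k (\<lambda>e. p e + s * q e) + h s" and
    alt: "\<And>i. i < 2*k \<Longrightarrow> t i < t (Suc i) \<and> cm_det k (\<lambda>e. p e + t i * q e) * cm_det k (\<lambda>e. p e + t (Suc i) * q e) < 0" and
    last: "cm_det k (\<lambda>e. p e + t (2*k) * q e) * h (t (2*k)) < 0"
    by blast
  define f where "f s = cm_det k (\<lambda>e. p e + s * q e)" for s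
  have f: "continuous_on UNIV f"
    unfolding f_def by (intro continuous_cm_det continuous_intros)
  obtain M c t' where t': "\<And>i. i < Suc (Suc (2 * k)) \<Longrightarrow> t' i < t' (Suc i) \<and>
       ((M * (t' i - c))\<^sup>2 * f (t' i) + h (t' i)) * ((M * (t' (Suc i) - c))\<^sup>2 * f (t' (Suc i)) + h (t' (Suc i))) < 0"
    "((M * (t' (Suc (Suc (2*k))) - c))\<^sup>2 * f (t' (Suc (Suc (2*k)))) + h (t' (Suc (Suc (2*k)))))
        * (- ((M * (t' (Suc (Suc (2*k))) - c))\<^sup>2 / 2)\<^sup>2 * f (t' (Suc (Suc (2*k))))) < 0"
    using alternating_line_step[OF f h alt[folded f_def] last[folded f_def]] by blast
  define p' where "p' = extend_by (Suc k) p (- M * c)"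
  define q' where "q' = extend_by (Suc k) q M"
  have line: "(\<lambda>e. p' e + s * q' e) = extend_by (Suc k) (\<lambda>e. p e + s * q e) (M * (s - c))" for s
    by (auto simp: p'_def q'_def extend_by_def algebra_simps)
  have f': "cm_det (Suc k) (\<lambda>e. p' e + s * q' e) = (M * (s - c))\<^sup>2 * f s + h s" for s
    unfolding line ext f_def ..
  define h' where "h' s = - ((M * (s - c))\<^sup>2 / 2)\<^sup>2 * f s" for s
  have supp': "p' e = 0 \<and> q' e = 0" if "e \<notin> edges (Suc (Suc k))" for e
    using that supp[of e] edges_mono[of "Suc k" "Suc (Suc k)"] by (auto simp: p'_def q'_def extend_by_def)
  have cont': "continuous_on UNIV h'" unfolding h'_def by (intro continuous_intros f) auto
  have ext': "cm_det (Suc (Suc k)) (extend_by (Suc (Suc k)) (\<lambda>e. p' e + s * q' e) l) =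
      l\<^sup>2 * cm_det (Suc k) (\<lambda>e. p' e + s * q' e) + h' s" for s l
    unfolding line cm_det_extend_by_twice by (simp add: h'_def f_def)
  have k: "2 * Suc k = Suc (Suc (2 * k))" by simp
  show ?case
    unfolding k using supp' cont' ext' t'[folded f' h'_def]
    by (intro exI[of _ p'] exI[of _ q'] exI[of _ t'] exI[of _ h'] conjI allI impI) auto
qed

text \<open>The parameter is shifted so that \<open>z\<close> is itself the first sample point. Its
  determinant is therefore nonzero, and \<open>z\<close> stays fixed when the direction
  \<open>q\<close> is perturbed.\<close>

lemma alternating_line:
  assumes "k \<ge> 2"
  obtains z q :: "nat set \<Rightarrow> real" and t where "\<And>e. e \<notin> edges (Suc k) \<Longrightarrow> z e = 0 \<and> q e = 0"
    "t 0 = 0" "\<And>i. i < 2*k \<Longrightarrow> t i < t (Suc i)"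
    "\<And>i. i < 2*k \<Longrightarrow> cm_det k (\<lambda>e. z e + t i * q e) * cm_det k (\<lambda>e. z e + t (Suc i) * q e) < 0"
proof -
  from alternating_line_aux[OF assms] obtain p q :: "nat set \<Rightarrow> real" and t where
    supp: "\<And>e. e \<notin> edges (Suc k) \<Longrightarrow> p e = 0 \<and> q e = 0" and
    alt: "\<And>i. i < 2*k \<Longrightarrow> t i < t (Suc i) \<and> cm_det k (\<lambda>e. p e + t i * q e) * cm_det k (\<lambda>e. p e + t (Suc i) * q e) < 0"
    by blast
  have "(\<lambda>e. (p e + t 0 * q e) + (s - t 0) * q e) = (\<lambda>e. p e + s * q e)" for s
    by (auto simp: algebra_simps)
  then show ?thesis
    using supp alt by (intro that[of "\<lambda>e. p e + t 0 * q e" q "\<lambda>i. t i - t 0"]) auto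
qed

section \<open>Linear maps preserving the variety\<close>

lemma poly_eq_0_if_many_roots:
  fixes p :: "'a::idom poly"
  assumes "degree p \<le> n" "inj_on r {..n}" "\<And>i. i \<le> n \<Longrightarrow> poly p (r i) = 0"
  shows "p = 0"
proof (rule ccontr)
  assume p: "p \<noteq> 0"
  have "card (r ` {..n}) \<le> card {x. poly p x = 0}"
    by (rule card_mono[OF poly_roots_finite[OF p]]) (use assms in auto)
  also have "\<dots> \<le> degree p" by (rule card_poly_roots_bound[OF p])
  finally show False using assms by (simp add: card_image)
qed

lemma poly_eq_0_if_real_eventually:
  fixes p :: "complex poly"
  assumes "\<forall>\<^sub>F s :: real in nhds 0. poly p (of_real s) = 0"
  shows "p = 0"
proof (rule ccontr)
  assume "p \<noteq> 0"
  then have fin: "finite {x. poly p x = 0}" by (rule poly_roots_finite)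
  obtain e where e: "e > 0" "\<And>s. \<bar>s\<bar> < e \<Longrightarrow> poly p (complex_of_real s) = 0"
    using assms by (auto simp: eventually_nhds_metric dist_real_def)
  have "complex_of_real ` {0<..<e} \<subseteq> {x. poly p x = 0}" using e by auto
  then have "finite (complex_of_real ` {0<..<e})" by (rule finite_subset) (rule fin)
  then have "finite {0<..<e}"
    by (subst (asm) finite_image_iff) (auto simp: inj_on_def)
  with infinite_Ioo[OF e(1)] show False by contradiction
qed

lemma alternating_roots:
  fixes f :: "real \<Rightarrow> real"
  assumes cont: "continuous_on UNIV f"
    and t: "\<And>i. i < n \<Longrightarrow> t i < t (Suc i)" and alt: "\<And>i. i < n \<Longrightarrow> f (t i) * f (t (Suc i)) < 0"
  obtains r where "inj_on r {..<n}" "\<And>i. i < n \<Longrightarrow> t 0 < r i" "\<And>i. i < n \<Longrightarrow> f (r i) = 0"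
proof -
  have "\<exists>r. t i < r \<and> r < t (Suc i) \<and> f r = 0" if i: "i < n" for i
  proof -
    have le: "t i \<le> t (Suc i)" using t[OF i] by simp
    have c: "continuous_on {t i..t (Suc i)} f" using cont by (rule continuous_on_subset) simp
    consider "f (t i) < 0" "f (t (Suc i)) > 0" | "f (t i) > 0" "f (t (Suc i)) < 0"
      using alt[OF i] by (auto simp: mult_less_0_iff)
    then obtain r where r: "t i \<le> r" "r \<le> t (Suc i)" "f r = 0"
      by cases (use IVT'[of f "t i" 0 "t (Suc i)", OF _ _ le c] IVT2'[of f "t (Suc i)" 0 "t i", OF _ _ le c]
          in \<open>auto dest: less_imp_le\<close>)
    moreover have "r \<noteq> t i" "r \<noteq> t (Suc i)" using r alt[OF i] by auto
    ultimately show ?thesis by (intro exI[of _ r]) auto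
  qed
  then obtain r where r: "\<And>i. i < n \<Longrightarrow> t i < r i \<and> r i < t (Suc i) \<and> f (r i) = 0" by metis
  have mono: "t i \<le> t j" if "i \<le> j" "j \<le> n" for i j
    using that
  proof (induction rule: dec_induct)
    case (step m) then show ?case using t[of m] by force
  qed simp
  have lt: "r i < r j" if "i < j" "j < n" for i j
    using r[of i] r[of j] mono[of "Suc i" j] that by force
  have "inj_on r {..<n}"
  proof (rule inj_onI)
    fix i j assume "i \<in> {..<n}" "j \<in> {..<n}" "r i = r j"
    then show "i = j" using lt[of i j] lt[of j i] by (cases i j rule: linorder_cases) auto
  qed
  moreover have "t 0 < r i" if "i < n" for i using r[OF that] mono[of 0 i] that by simp
  ultimately show ?thesis using that r by blast
qed

text \<open>On a line through \<open>z\<close> with \<open>2 * k\<close> sign changes,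
  \<open>a\<close> times the composed form minus \<open>b\<close> times the original has degree at
  most \<open>2 * k\<close>. It vanishes at the \<open>2 * k\<close> roots and, by the choice of
  \<open>a\<close> and \<open>b\<close>, at \<open>z\<close>, so it is zero. Alternation is an open
  condition, which spreads the identity to all real vectors and then to complex ones.\<close>

lemma cm_det_linear_preserver:
  fixes \<Phi> :: "(nat set \<Rightarrow> complex) \<Rightarrow> nat set \<Rightarrow> complex"
  assumes k: "k \<ge> 2"
    and lin: "\<And>x y c. \<Phi> (\<lambda>e. x e + c * y e) = (\<lambda>e. \<Phi> x e + c * \<Phi> y e)"
    and zero: "\<And>x. x \<in> edge_space (Suc k) \<Longrightarrow> cm_det k x = 0 \<Longrightarrow> cm_det k (\<Phi> x) = 0"
  obtains \<mu> where "\<And>x. x \<in> edge_space (Suc k) \<Longrightarrow> cm_det k (\<Phi> x) = \<mu> * cm_det k x"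
proof -
  let ?C = "\<lambda>(v :: nat set \<Rightarrow> real) e. complex_of_real (v e)"
  obtain z q :: "nat set \<Rightarrow> real" and t where
    supp: "\<And>e. e \<notin> edges (Suc k) \<Longrightarrow> z e = 0 \<and> q e = 0" and t0: "t 0 = 0" and
    t: "\<And>i. i < 2*k \<Longrightarrow> t i < t (Suc i)" and
    alt: "\<And>i. i < 2*k \<Longrightarrow> cm_det k (\<lambda>e. z e + t i * q e) * cm_det k (\<lambda>e. z e + t (Suc i) * q e) < 0"
    using alternating_line[OF k] by blast
  define a where "a = cm_det k (?C z)"
  define b where "b = cm_det k (\<Phi> (?C z))"
  have z0: "a \<noteq> 0"
    using alt[of 0] k t0 by (auto simp: a_def cm_det_of_real)
  have on_line: "a * cm_det k (\<Phi> (\<lambda>e. ?C z e + 1 * ?C w e)) = b * cm_det k (\<lambda>e. ?C z e + 1 * ?C w e)"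
    if w: "\<And>e. e \<notin> edges (Suc k) \<Longrightarrow> w e = 0" and
      walt: "\<And>i. i < 2*k \<Longrightarrow> cm_det k (\<lambda>e. z e + t i * w e) * cm_det k (\<lambda>e. z e + t (Suc i) * w e) < 0" for w
  proof -
    obtain P where P: "degree P \<le> 2 * k" "\<And>t. poly P t = cm_det k (\<lambda>e. ?C z e + t * ?C w e)"
      using cm_det_line_poly[of k "?C z" "?C w"] by blast
    obtain H where H: "degree H \<le> 2 * k" "\<And>t. poly H t = cm_det k (\<lambda>e. \<Phi> (?C z) e + t * \<Phi> (?C w) e)"
      using cm_det_line_poly[of k "\<Phi> (?C z)" "\<Phi> (?C w)"] by blast
    have cont: "continuous_on UNIV (\<lambda>s. cm_det k (\<lambda>e. z e + s * w e))"
      by (intro continuous_cm_det continuous_intros)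
    obtain r where r: "inj_on r {..<2*k}" "\<And>i. i < 2*k \<Longrightarrow> t 0 < r i"
      "\<And>i. i < 2*k \<Longrightarrow> cm_det k (\<lambda>e. z e + r i * w e) = 0"
      using alternating_roots[OF cont, of "2 * k" t, OF t walt] by blast
    \<comment> \<open>The last root 0 stands for \<open>z\<close> itself; the others are
      positive.\<close>
    define R where "R i = (if i < 2*k then complex_of_real (r i) else 0)" for i
    let ?Q = "smult a H - smult b P"
    have "?Q = 0"
    proof (rule poly_eq_0_if_many_roots)
      show "degree ?Q \<le> 2 * k"
        using P(1) H(1) by (intro degree_diff_le order_trans[OF degree_smult_le])
      show "inj_on R {..2*k}"
        using r(1,2) t0 by (fastforce simp: inj_on_def R_def)
      fix i assume "i \<le> 2 * k"
      show "poly ?Q (R i) = 0"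
      proof (cases "i < 2 * k")
        case False
        then show ?thesis by (simp add: R_def P H a_def b_def)
      next
        case True
        have eq: "(\<lambda>e. ?C z e + R i * ?C w e) = ?C (\<lambda>e. z e + r i * w e)"
          using True by (simp add: R_def)
        have "poly P (R i) = 0"
          unfolding P eq cm_det_of_real using r(3)[OF True] by simp
        moreover have "poly H (R i) = 0"
          unfolding H lin[symmetric] eq
        proof (rule zero)
          show "?C (\<lambda>e. z e + r i * w e) \<in> edge_space (Suc k)"
            using supp w by (simp add: edge_space_def)
          show "cm_det k (?C (\<lambda>e. z e + r i * w e)) = 0"
            unfolding cm_det_of_real using r(3)[OF True] by simp
        qed
        ultimately show ?thesis by simp
      qed
    qed
    then have "poly ?Q 1 = 0" by simp
    then show ?thesis unfolding lin by (simp add: P H)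
  qed
  have line_identity: "a * cm_det k (\<Phi> (\<lambda>e. x e + s * y e)) = b * cm_det k (\<lambda>e. x e + s * y e)"
    if ev: "\<forall>\<^sub>F s :: real in nhds 0. a * cm_det k (\<Phi> (\<lambda>e. x e + of_real s * y e)) = b * cm_det k (\<lambda>e. x e + of_real s * y e)"
    for x y s
  proof -
    obtain P where P: "\<And>t. poly P t = cm_det k (\<lambda>e. x e + t * y e)"
      using cm_det_line_poly[of k x y] by blast
    obtain H where H: "\<And>t. poly H t = cm_det k (\<lambda>e. \<Phi> x e + t * \<Phi> y e)"
      using cm_det_line_poly[of k "\<Phi> x" "\<Phi> y"] by blast
    have "smult a H - smult b P = 0"
      by (rule poly_eq_0_if_real_eventually) (use ev in \<open>simp add: P H lin\<close>)
    then have "poly (smult a H - smult b P) s = 0" by simp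
    then show ?thesis unfolding lin by (simp add: P H)
  qed
  have real_identity: "a * cm_det k (\<Phi> (?C x)) = b * cm_det k (?C x)"
    if x: "\<And>e. e \<notin> edges (Suc k) \<Longrightarrow> x e = 0" for x
  proof -
    \<comment> \<open>The line through \<open>z + q\<close> in direction \<open>y\<close> reaches
      \<open>x\<close> at parameter 1. Its points near parameter 0 lie on lines through
      \<open>z\<close> that still alternate.\<close>
    define y where "y e = x e - z e - q e" for e
    have "\<forall>\<^sub>F s in nhds 0. \<forall>i\<in>{..<2*k}. cm_det k (\<lambda>e. z e + t i * (q e + s * y e)) * cm_det k (\<lambda>e. z e + t (Suc i) * (q e + s * y e)) < 0"
    proof (intro eventually_ball_finite ballI)
      fix i assume i: "i \<in> {..<2*k}"
      let ?g = "\<lambda>s. cm_det k (\<lambda>e. z e + t i * (q e + s * y e)) * cm_det k (\<lambda>e. z e + t (Suc i) * (q e + s * y e))"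
      have "continuous_on UNIV ?g" by (intro continuous_cm_det continuous_intros)
      then have "isCont ?g 0" using continuous_on_eq_continuous_at[OF open_UNIV, of ?g] by blast
      then have "(?g \<longlongrightarrow> ?g 0) (nhds 0)" by (simp only: isCont_def tendsto_at_iff_tendsto_nhds[of ?g])
      moreover have "?g 0 < 0" using alt i by simp
      ultimately show "\<forall>\<^sub>F s in nhds 0. ?g s < 0" by (rule order_tendstoD)
    qed simp
    then have "\<forall>\<^sub>F s in nhds 0. a * cm_det k (\<Phi> (\<lambda>e. (?C z e + ?C q e) + of_real s * ?C y e)) =
        b * cm_det k (\<lambda>e. (?C z e + ?C q e) + of_real s * ?C y e)"
    proof eventually_elim
      case (elim s)
      have "(\<lambda>e. (?C z e + ?C q e) + of_real s * ?C y e) = (\<lambda>e. ?C z e + 1 * ?C (\<lambda>e. q e + s * y e) e)"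
        by auto
      then show ?case
        by (simp only:) (rule on_line, use x supp elim in \<open>auto simp: y_def\<close>)
    qed
    from line_identity[OF this, of 1] show ?thesis
      by (simp add: y_def)
  qed
  \<comment> \<open>The line through the real part in the direction of the imaginary part has real
    points at real parameters; the identity is then evaluated at \<i>.\<close>
  have "a * cm_det k (\<Phi> x) = b * cm_det k x" if x: "x \<in> edge_space (Suc k)" for x
  proof -
    have "a * cm_det k (\<Phi> (\<lambda>e. of_real (Re (x e)) + of_real s * of_real (Im (x e)))) =
        b * cm_det k (\<lambda>e. of_real (Re (x e)) + of_real s * of_real (Im (x e)))" for s
      using real_identity[of "\<lambda>e. Re (x e) + s * Im (x e)"] x by (simp add: edge_space_def)
    then have "a * cm_det k (\<Phi> (\<lambda>e. of_real (Re (x e)) + \<i> * of_real (Im (x e)))) =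
        b * cm_det k (\<lambda>e. of_real (Re (x e)) + \<i> * of_real (Im (x e)))"
      by (intro line_identity always_eventually) auto
    then show ?thesis by (simp flip: complex_eq)
  qed
  then have "cm_det k (\<Phi> x) = b / a * cm_det k x" if "x \<in> edge_space (Suc k)" for x
    using that z0 by (simp add: field_simps)
  then show ?thesis by (rule that)
qed

section \<open>Directions of quadratic growth\<close>

definition star_vec :: "nat \<Rightarrow> nat \<Rightarrow> (nat set \<Rightarrow> complex) \<Rightarrow> bool" where
  "star_vec n a v \<longleftrightarrow> a < n \<and>
    (\<exists>\<gamma>. \<gamma> \<noteq> 0 \<and> (\<forall>e. (v e)\<^sup>2 = (if e \<in> edges n \<and> a \<in> e then \<gamma> else 0)))"

definition quadratic_direction :: "nat \<Rightarrow> (nat set \<Rightarrow> complex) \<Rightarrow> bool" where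
  "quadratic_direction k v \<longleftrightarrow> (\<forall>x\<in>edge_space (Suc k).
    \<exists>P. degree P \<le> 2 \<and> (\<forall>t. poly P t = cm_det k (\<lambda>e. x e + t * v e)))"

text \<open>Equal squares cancel: for the centre \<open>Suc r\<close> an entry \<open>(r, j)\<close>
  off the diagonal has quadratic coefficient \<open>(\<gamma> + 0 - \<gamma>) / 2\<close>. So row
  and column \<open>r\<close> are linear in \<open>t\<close> except on the diagonal, and all other
  entries are constant. For the centre 0 the same shape appears after rebasing.\<close>

lemma star_vec_quadratic_direction:
  assumes "star_vec (Suc k) a v"
  shows "quadratic_direction k v"
  unfolding quadratic_direction_def
proof
  fix x
  from assms obtain \<gamma> where a: "a < Suc k" and v: "\<And>e. (v e)\<^sup>2 = (if e \<in> edges (Suc k) \<and> a \<in> e then \<gamma> else 0)"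
    by (auto simp: star_vec_def)
  have v0: "v e = 0" if "e \<notin> edges (Suc k) \<or> a \<notin> e" for e
    using v[of e] that by auto
  define q where "q i j = [:gram (\<lambda>e. (x e)\<^sup>2) i j, gram (\<lambda>e. 2 * x e * v e) i j, gram (\<lambda>e. (v e)\<^sup>2) i j:]" for i j
  have q: "gram (\<lambda>e. (x e + t * v e)\<^sup>2) i j = poly (q i j) t" for t i j
    by (simp add: q_def gram_def field_simps power2_eq_square)
  show "\<exists>P. degree P \<le> 2 \<and> (\<forall>t. poly P t = cm_det k (\<lambda>e. x e + t * v e))"
  proof (cases a)
    case (Suc r)
    define \<alpha> :: "nat \<Rightarrow> nat" where "\<alpha> i = (if i = r then 1 else 0)" for i
    have "degree (q i j) \<le> \<alpha> i + \<alpha> j" if "i < k" "j < k" for i j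
      using that Suc a by (auto simp: q_def \<alpha>_def gram_def v v0 doubleton_in_edges)
    from det_poly_entries[of k q \<alpha>, OF this] obtain P where P: "degree P \<le> 2 * (\<Sum>i<k. \<alpha> i)"
      "\<And>t. poly P t = det (mat k k (\<lambda>(i, j). poly (q i j) t))" by metis
    have "(\<Sum>i<k. \<alpha> i) \<le> 1" by (simp add: \<alpha>_def)
    then show ?thesis using P by (intro exI[of _ P]) (auto simp: cm_det_def q)
  next
    case 0
    show ?thesis
    proof (cases "k = 0")
      case True
      then show ?thesis by (intro exI[of _ 1]) (auto simp: cm_det_def)
    next
      case False
      define q' where "q' i j = q i j - (if i = 0 then 0 else q 0 j)
        - (if j = 0 then 0 else q i 0 - (if i = 0 then 0 else q 0 0))" for i j
      define \<alpha> :: "nat \<Rightarrow> nat" where "\<alpha> i = (if i = 0 then 1 else 0)" for i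
      have "degree (q' i j) \<le> \<alpha> i + \<alpha> j" if "i < k" "j < k" for i j
        using that 0 by (auto simp: q'_def q_def \<alpha>_def gram_def v v0 doubleton_in_edges field_simps)
      from det_poly_entries[of k q' \<alpha>, OF this] obtain P where P: "degree P \<le> 2 * (\<Sum>i<k. \<alpha> i)"
        "\<And>t. poly P t = det (mat k k (\<lambda>(i, j). poly (q' i j) t))" by metis
      have "cm_det k (\<lambda>e. x e + t * v e) = poly P t" for t
        unfolding cm_det_def q P
        by (subst det_mat_subtract_first) (use False in \<open>auto intro!: det_mat_cong simp: q'_def\<close>)
      moreover have "(\<Sum>i<k. \<alpha> i) \<le> 1" by (simp add: \<alpha>_def)
      ultimately show ?thesis using P(1) by (intro exI[of _ P]) auto
    qed
  qed
qed

section \<open>Growth estimates uniform in a bounded base point\<close>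

lemma cm_det_bounded:
  fixes B :: real
  obtains C where "\<And>x :: nat set \<Rightarrow> complex. (\<And>e. norm (x e) \<le> B) \<Longrightarrow> norm (cm_det k x) \<le> C"
proof
  fix x :: "nat set \<Rightarrow> complex" assume x: "\<And>e. norm (x e) \<le> B"
  have x2: "norm ((x e)\<^sup>2) \<le> B\<^sup>2" for e
    using x[of e] by (simp add: norm_power power_mono)
  have g: "norm (gram (\<lambda>e. (x e)\<^sup>2) i j) \<le> 2 * B\<^sup>2" for i j
  proof -
    have "norm ((x {0, Suc i})\<^sup>2 + (x {0, Suc j})\<^sup>2 - (if i = j then 0 else (x {Suc i, Suc j})\<^sup>2))
        \<le> B\<^sup>2 + B\<^sup>2 + B\<^sup>2"
      by (intro norm_triangle_le_diff norm_triangle_le add_mono x2) (use x2 in auto)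
    then have "norm ((x {0, Suc i})\<^sup>2 + (x {0, Suc j})\<^sup>2 - (if i = j then 0 else (x {Suc i, Suc j})\<^sup>2)) / 2
        \<le> 2 * B\<^sup>2"
      using zero_le_power2[of B] by linarith
    then show ?thesis by (simp only: gram_def norm_divide norm_numeral)
  qed
  have "norm (cm_det k x) \<le> (\<Sum>p | p permutes {0..<k}. (2 * B\<^sup>2) ^ k)"
    unfolding cm_det_def det_mat_leibniz
  proof (rule sum_norm_le)
    fix p
    have "norm (signof p * (\<Prod>i = 0..<k. gram (\<lambda>e. (x e)\<^sup>2) i (p i)))
        = (\<Prod>i = 0..<k. norm (gram (\<lambda>e. (x e)\<^sup>2) i (p i)))"
      by (simp add: norm_mult prod_norm sign_def)
    also have "\<dots> \<le> (\<Prod>i = 0..<k. 2 * B\<^sup>2)"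
      by (rule prod_mono) (use g in auto)
    finally show "norm (signof p * (\<Prod>i = 0..<k. gram (\<lambda>e. (x e)\<^sup>2) i (p i))) \<le> (2 * B\<^sup>2) ^ k" by simp
  qed
  then show "norm (cm_det k x) \<le> (\<Sum>p | p permutes {0..<k}. (2 * B\<^sup>2) ^ k)" .
qed

lemma poly_degree_le_2E:
  assumes "degree P \<le> 2"
  obtains a b c where "P = [:a, b, c:]"
proof (rule that)
  show "P = [:coeff P 0, coeff P 1, coeff P 2:]"
    using assms by (intro poly_eqI)
      (auto simp: coeff_pCons coeff_eq_0 numeral_2_eq_2 split: nat.split)
qed

text \<open>Lagrange interpolation at 0, 1 and -1: for \<open>t \<ge> 1\<close> each of the three
  basis polynomials is at most \<open>t\<^sup>2\<close> in absolute value.\<close>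

lemma quadratic_growth:
  fixes P :: "complex poly" and t C :: real
  assumes "degree P \<le> 2" "norm (poly P 0) \<le> C" "norm (poly P 1) \<le> C" "norm (poly P (-1)) \<le> C" "t \<ge> 1"
  shows "norm (poly P (of_real t)) \<le> 3 * C * t\<^sup>2"
proof -
  obtain a b c where P: "P = [:a, b, c:]" using assms(1) by (rule poly_degree_le_2E)
  have t: "t \<le> t\<^sup>2" "1 \<le> t\<^sup>2" using assms(5) by (auto simp: power2_eq_square self_le_power intro: mult_mono order_trans)
  have "poly P (of_real t) = of_real (1 - t\<^sup>2) * poly P 0 + of_real ((t\<^sup>2 + t) / 2) * poly P 1
      + of_real ((t\<^sup>2 - t) / 2) * poly P (-1)"
    by (simp add: P field_simps power2_eq_square)
  also have "norm \<dots> \<le> t\<^sup>2 * C + t\<^sup>2 * C + t\<^sup>2 * C"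
  proof -
    have "norm (of_real (1 - t\<^sup>2) * poly P 0) \<le> t\<^sup>2 * C"
      "norm (of_real ((t\<^sup>2 + t) / 2) * poly P 1) \<le> t\<^sup>2 * C"
      "norm (of_real ((t\<^sup>2 - t) / 2) * poly P (-1)) \<le> t\<^sup>2 * C"
      unfolding norm_mult norm_of_real by (intro mult_mono assms; use t assms(5) in simp)+
    then show ?thesis by (intro norm_triangle_le add_mono)
  qed
  finally show ?thesis by simp
qed

text \<open>Otherwise, after removing two coefficients and dividing by \<open>t\<^sup>2\<close>, a
  nonconstant polynomial \<open>pCons c S\<close> would stay bounded on a real ray.\<close>

lemma degree_le_2_if_quadratic_growth:
  fixes P :: "complex poly"
  assumes "\<And>t :: real. t \<ge> 1 \<Longrightarrow> norm (poly P (of_real t)) \<le> K * t\<^sup>2"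
  shows "degree P \<le> 2"
proof (rule ccontr)
  assume "\<not> degree P \<le> 2"
  obtain a Q where Q: "P = pCons a Q" by (cases P)
  obtain b R where R: "Q = pCons b R" by (cases Q)
  obtain c S where S: "R = pCons c S" by (cases R)
  have P: "P = pCons a (pCons b (pCons c S))" by (simp add: Q R S)
  have "degree [:a, b, c:] \<le> 2"
    using degree_pCons_le[of a "[:b, c:]"] degree_pCons_le[of b "[:c:]"] degree_pCons_0[of c] by linarith
  then have "S \<noteq> 0" using \<open>\<not> degree P \<le> 2\<close> P by auto
  from poly_infinity[OF this, of "K + norm a + norm b + 1" c] obtain r where
    r: "\<And>z. r \<le> norm z \<Longrightarrow> K + norm a + norm b + 1 \<le> norm (poly (pCons c S) z)" by blast
  define t where "t = max 1 r"
  have t: "t \<ge> 1" "r \<le> t" by (auto simp: t_def)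
  have t2: "t \<le> t\<^sup>2" "1 \<le> t\<^sup>2" using t(1) by (auto simp: power2_eq_square intro: order_trans)
  define z where "z = complex_of_real t"
  have "norm (z\<^sup>2 * poly (pCons c S) z) = norm (poly P z - a - z * b)"
    by (simp add: P power2_eq_square algebra_simps)
  also have "\<dots> \<le> K * t\<^sup>2 + norm a + t * norm b"
    by (intro norm_triangle_le_diff add_mono) (use assms[OF t(1)] t in \<open>auto simp: z_def norm_mult\<close>)
  also have "\<dots> \<le> t\<^sup>2 * (K + norm a + norm b)"
    using mult_right_mono[OF t2(2), of "norm a"] mult_right_mono[OF t2(1), of "norm b"] by (simp add: algebra_simps)
  finally have "t\<^sup>2 * norm (poly (pCons c S) z) \<le> t\<^sup>2 * (K + norm a + norm b)"
    using t by (simp add: norm_mult norm_power z_def)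
  then have "norm (poly (pCons c S) z) \<le> K + norm a + norm b"
    using t(1) by (simp add: mult_le_cancel_left_pos)
  moreover have "K + norm a + norm b + 1 \<le> norm (poly (pCons c S) z)"
    using t by (intro r) (simp add: z_def)
  ultimately show False by simp
qed

text \<open>The minor is the coefficient of the power \<open>k - card W\<close> of
  \<open>\<beta>\<close>: a permutation moving an index outside \<open>W\<close> loses a factor
  \<open>\<beta>\<close> there, and those fixing all such indices are the permutations of
  \<open>W\<close>.\<close>

lemma principal_minor_limit:
  fixes N :: "nat \<Rightarrow> nat \<Rightarrow> complex"
  assumes W: "W \<subseteq> {0..<k}"
  shows "((\<lambda>\<beta>::real. det (mat k k (\<lambda>(i, j). N i j + of_real \<beta> * (if i = j \<and> i \<notin> W then 1 else 0)))
      / of_real \<beta> ^ (k - card W)) \<longlongrightarrow> principal_minor W N) at_top"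
proof -
  let ?S = "{0..<k} - W"
  have fin: "finite W" using W finite_subset by blast
  have card: "card ?S = k - card W" using W fin by (simp add: card_Diff_subset)
  define T where "T p \<beta> = signof p * ((\<Prod>i\<in>W. N i (p i)) *
    (\<Prod>i\<in>?S. N i (p i) / of_real \<beta> + (if i = p i then 1 else 0)))" for p and \<beta> :: real
  have "((\<lambda>\<beta>. \<Sum>p | p permutes {0..<k}. T p \<beta>) \<longlongrightarrow>
      (\<Sum>p | p permutes {0..<k}. signof p * ((\<Prod>i\<in>W. N i (p i)) *
        (\<Prod>i\<in>?S. 0 + (if i = p i then 1 else 0))))) at_top"
    unfolding T_def
  proof (intro tendsto_intros)
    fix p i
    have "filterlim (\<lambda>\<beta>::real. complex_of_real \<beta>) at_infinity at_top"
      by (simp add: filterlim_at_infinity_conv_norm_at_top filterlim_abs_real)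
    then show "((\<lambda>\<beta>. N i (p i) / complex_of_real \<beta>) \<longlongrightarrow> 0) at_top"
      by (intro tendsto_divide_0[OF tendsto_const])
  qed
  also have "(\<Sum>p | p permutes {0..<k}. signof p * ((\<Prod>i\<in>W. N i (p i)) *
        (\<Prod>i\<in>?S. 0 + (if i = p i then 1 else 0)))) = principal_minor W N"
  proof -
    have sub: "{p. p permutes W} \<subseteq> {p. p permutes {0..<k}}"
      using W by (auto intro: permutes_subset)
    have "(\<Sum>p | p permutes {0..<k}. signof p * ((\<Prod>i\<in>W. N i (p i)) * (\<Prod>i\<in>?S. 0 + (if i = p i then 1 else 0))))
      = (\<Sum>p | p permutes W. signof p * ((\<Prod>i\<in>W. N i (p i)) * (\<Prod>i\<in>?S. 0 + (if i = p i then 1 else 0))))"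
    proof (rule sum.mono_neutral_right[OF _ sub])
      show "\<forall>p\<in>{p. p permutes {0..<k}} - {p. p permutes W}.
        signof p * ((\<Prod>i\<in>W. N i (p i)) * (\<Prod>i\<in>?S. 0 + (if i = p i then 1 else 0))) = 0"
      proof
        fix p assume p: "p \<in> {p. p permutes {0..<k}} - {p. p permutes W}"
        then have "\<not> (\<forall>i\<in>?S. p i = i)"
          by (auto dest: permutes_superset)
        then obtain i where "i \<in> ?S" "i \<noteq> p i" by auto
        then have "(\<Prod>i\<in>?S. 0 + (if i = p i then 1 else (0::complex))) = 0"
          by (intro prod_zero) auto
        then show "signof p * ((\<Prod>i\<in>W. N i (p i)) * (\<Prod>i\<in>?S. 0 + (if i = p i then 1 else 0))) = 0"
          by simp
      qed
    qed (simp add: finite_permutations)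
    also have "\<dots> = principal_minor W N"
      unfolding principal_minor_def
    proof (rule sum.cong[OF refl])
      fix p assume "p \<in> {p. p permutes W}"
      then have "\<And>i. i \<in> ?S \<Longrightarrow> i = p i" by (auto simp: permutes_not_in)
      then show "signof p * ((\<Prod>i\<in>W. N i (p i)) * (\<Prod>i\<in>?S. 0 + (if i = p i then 1 else 0)))
        = signof p * (\<Prod>i\<in>W. N i (p i))" by (simp add: prod.neutral)
    qed
    finally show ?thesis .
  qed
  finally show ?thesis
  proof (rule Lim_transform_eventually)
    show "\<forall>\<^sub>F \<beta> in at_top. (\<Sum>p | p permutes {0..<k}. T p \<beta>) =
      det (mat k k (\<lambda>(i, j). N i j + of_real \<beta> * (if i = j \<and> i \<notin> W then 1 else 0))) / of_real \<beta> ^ (k - card W)"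
      using eventually_gt_at_top[of 0]
    proof eventually_elim
      case (elim \<beta>)
      have "signof p * (\<Prod>i = 0..<k. N i (p i) + of_real \<beta> * (if i = p i \<and> i \<notin> W then 1 else 0)) / of_real \<beta> ^ (k - card W)
          = T p \<beta>" for p
      proof -
        have "(\<Prod>i = 0..<k. N i (p i) + of_real \<beta> * (if i = p i \<and> i \<notin> W then 1 else 0)) =
          (\<Prod>i\<in>?S. N i (p i) + of_real \<beta> * (if i = p i \<and> i \<notin> W then 1 else 0)) *
          (\<Prod>i\<in>W. N i (p i) + of_real \<beta> * (if i = p i \<and> i \<notin> W then 1 else 0))"
          by (rule prod.subset_diff[OF W]) simp
        also have "(\<Prod>i\<in>?S. N i (p i) + of_real \<beta> * (if i = p i \<and> i \<notin> W then 1 else 0)) =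
          (\<Prod>i\<in>?S. of_real \<beta> * (N i (p i) / of_real \<beta> + (if i = p i then 1 else 0)))"
          by (rule prod.cong) (use elim in \<open>auto simp: field_simps\<close>)
        also have "\<dots> = of_real \<beta> ^ (k - card W) * (\<Prod>i\<in>?S. N i (p i) / of_real \<beta> + (if i = p i then 1 else 0))"
          by (simp add: prod.distrib card)
        also have "(\<Prod>i\<in>W. N i (p i) + of_real \<beta> * (if i = p i \<and> i \<notin> W then 1 else 0)) = (\<Prod>i\<in>W. N i (p i))"
          by (rule prod.cong) auto
        finally show ?thesis using elim by (simp add: T_def)
      qed
      then show ?case unfolding det_mat_leibniz sum_divide_distrib by simp
    qed
  qed
qed

lemma gram_add_scaled: "gram (\<lambda>e. f e + c * g e) i j = gram f i j + c * gram g i j"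
  by (simp add: gram_def add_divide_distrib diff_divide_distrib algebra_simps)

text \<open>For a square root \<open>y\<close> of \<open>v\<^sup>2 + w\<close> the numbers
  \<open>y - v\<close> and \<open>y + v\<close> have product \<open>w\<close> and differ by
  \<open>2 * v\<close>. One of them has norm at least that of \<open>v\<close>, so the other is
  small and serves as \<open>x\<close> up to sign. With \<open>t * v\<close> for \<open>v\<close>,
  the correction \<open>x\<close> stays bounded as \<open>t\<close> grows.\<close>

lemma square_root_shift:
  fixes v w :: complex
  obtains x where "(x + v)\<^sup>2 = v\<^sup>2 + w" "norm x * norm v \<le> norm w"
proof -
  define y where "y = csqrt (v\<^sup>2 + w)"
  have y: "y\<^sup>2 = v\<^sup>2 + w" by (simp add: y_def)
  have sgn: "norm v \<le> norm (y + v) \<or> norm v \<le> norm (y - v)"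
    using norm_triangle_ineq4[of "y + v" "y - v"] by (auto simp: norm_mult simp flip: mult_2)
  have prod: "(y - v) * (y + v) = w" using y by (simp add: algebra_simps power2_eq_square)
  from sgn show ?thesis
  proof
    assume "norm v \<le> norm (y + v)"
    then have "norm (y - v) * norm v \<le> norm (y - v) * norm (y + v)" by (rule mult_left_mono) simp
    then show ?thesis using that[of "y - v"] y prod by (simp flip: norm_mult)
  next
    assume "norm v \<le> norm (y - v)"
    then have "norm (y + v) * norm v \<le> norm (y + v) * norm (y - v)" by (rule mult_left_mono) simp
    moreover have "norm (- y - v) = norm (y + v)" using norm_minus_cancel[of "y + v"] by simp
    moreover have "norm (y + v) * norm (y - v) = norm w" using prod by (metis mult.commute norm_mult)
    ultimately have "norm (- y - v) * norm v \<le> norm w" by simp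
    then show ?thesis using that[of "- y - v"] y by simp
  qed
qed

text \<open>
  Off the vertex set \<open>W\<^sub>0\<close> the base point \<open>x\<close> may move with \<open>t\<close>, as long as it stays bounded:
  choosing \<open>(x + t v)\<^sup>2 = t\<^sup>2 v\<^sup>2 + \<beta> \<kappa>\<close> there adds \<open>\<beta>\<close> to the diagonal entries outside \<open>W\<close>,
  and \<open>\<beta> \<rightarrow> \<infinity>\<close> isolates the principal minor. The third difference of a quadratic polynomial vanishes.
\<close>
lemma quadratic_direction_minor:
  fixes y :: "nat set \<Rightarrow> complex"
  assumes v: "quadratic_direction k v" "v \<in> edge_space (Suc k)" and W: "W \<subseteq> {0..<k}"
  defines "H \<equiv> \<lambda>t. principal_minor W (gram (\<lambda>e. (y e + t * v e)\<^sup>2))"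
  shows "H 3 - 3 * H 2 + 3 * H 1 - H 0 = 0"
proof -
  define W0 where "W0 = insert 0 (Suc ` W)"
  define \<mu> where "\<mu> t e = (if e \<subseteq> W0 then (y e + t * v e)\<^sup>2 else (t * v e)\<^sup>2)" for t e
  \<comment> \<open>On edges this is the squared distance when \<open>W0\<close> sits at the origin
    and the other vertices at orthonormal vectors; hence the diagonal Gram matrix.\<close>
  define \<kappa> where "\<kappa> e = complex_of_nat (card (e - W0))" for e
  define N where "N t = gram (\<mu> t)" for t
  have \<kappa>: "gram \<kappa> i j = (if i = j \<and> i \<notin> W then 1 else 0)" for i j
  proof -
    have "\<kappa> {0, Suc i} = (if i \<in> W then 0 else 1)" for i
      by (auto simp: \<kappa>_def W0_def insert_Diff_if)
    moreover have "\<kappa> {Suc i, Suc j} = (if i \<in> W then 0 else 1) + (if j \<in> W then 0 else 1)" if "i \<noteq> j" for i j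
      using that by (auto simp: \<kappa>_def W0_def insert_Diff_if)
    ultimately show ?thesis by (simp add: gram_def)
  qed
  define f where "f \<beta> t = det (mat k k (\<lambda>(i, j). N t i j + of_real \<beta> * (if i = j \<and> i \<notin> W then 1 else 0)))"
    for \<beta> :: real and t :: complex
  have f_gram: "f \<beta> t = det (mat k k (\<lambda>(i, j). gram (\<lambda>e. \<mu> t e + of_real \<beta> * \<kappa> e) i j))" for \<beta> t
    unfolding f_def gram_add_scaled \<kappa> N_def ..
  have third: "f \<beta> 3 - 3 * f \<beta> 2 + 3 * f \<beta> 1 - f \<beta> 0 = 0" for \<beta>
  proof -
    define q where "q i j = [:gram (\<lambda>e. (if e \<subseteq> W0 then (y e)\<^sup>2 else 0) + of_real \<beta> * \<kappa> e) i j,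
      gram (\<lambda>e. if e \<subseteq> W0 then 2 * y e * v e else 0) i j, gram (\<lambda>e. (v e)\<^sup>2) i j:]" for i j
    have q: "gram (\<lambda>e. \<mu> t e + of_real \<beta> * \<kappa> e) i j = poly (q i j) t" for t i j
    proof -
      have "\<mu> t e + of_real \<beta> * \<kappa> e = ((if e \<subseteq> W0 then (y e)\<^sup>2 else 0) + of_real \<beta> * \<kappa> e)
          + t * (if e \<subseteq> W0 then 2 * y e * v e else 0) + t\<^sup>2 * (v e)\<^sup>2" for e
        by (simp add: \<mu>_def power2_eq_square algebra_simps)
      then show ?thesis
        by (simp only: q_def gram_add_scaled) (simp add: algebra_simps power2_eq_square)
    qed
    have "degree (q i j) \<le> 1 + 1" for i j by (simp add: q_def)
    from det_poly_entries[of k q "\<lambda>_. 1", OF this] obtain P where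
      P: "\<And>t. poly P t = f \<beta> t" unfolding f_gram q by metis
    have "\<exists>K. \<forall>t\<ge>1. norm (poly P (complex_of_real t)) \<le> K * t\<^sup>2"
    proof -
      have "\<exists>x. norm x \<le> norm (y e) + norm (csqrt (\<beta> * \<kappa> e)) + norm (\<beta> * \<kappa> e) / norm (v e) \<and> (x + t * v e)\<^sup>2 = \<mu> t e + of_real \<beta> * \<kappa> e"
        if t: "t \<ge> 1" for t :: real and e
      proof -
        let ?b = "norm (y e) + norm (csqrt (\<beta> * \<kappa> e)) + norm (\<beta> * \<kappa> e) / norm (v e)"
        consider "e \<subseteq> W0" | "\<not> e \<subseteq> W0" "v e = 0" | "\<not> e \<subseteq> W0" "v e \<noteq> 0" by blast
        then show ?thesis
        proof cases
          case 1
          then have "\<kappa> e = 0" by (simp add: \<kappa>_def Diff_eq_empty_iff[THEN iffD2])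
          then show ?thesis using 1 by (intro exI[of _ "y e"]) (simp add: \<mu>_def)
        next
          case 2
          then show ?thesis by (intro exI[of _ "csqrt (\<beta> * \<kappa> e)"]) (auto simp: \<mu>_def)
        next
          case 3
          obtain x where x: "(x + t * v e)\<^sup>2 = (t * v e)\<^sup>2 + \<beta> * \<kappa> e" "norm x * norm (t * v e) \<le> norm (\<beta> * \<kappa> e)"
            by (rule square_root_shift)
          have "norm x * norm (v e) * 1 \<le> norm x * norm (v e) * t"
            using t by (intro mult_left_mono) auto
          also have "\<dots> \<le> norm (\<beta> * \<kappa> e)" using x(2) t by (simp add: norm_mult mult_ac)
          finally have "norm x \<le> norm (\<beta> * \<kappa> e) / norm (v e)" using 3 by (simp add: field_simps)
          also have "\<dots> \<le> ?b" by simp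
          finally show ?thesis using x(1) 3 by (intro exI[of _ x]) (auto simp: \<mu>_def)
        qed
      qed
      then obtain X :: "real \<Rightarrow> nat set \<Rightarrow> complex" where X: "\<And>t e. t \<ge> (1::real) \<Longrightarrow> norm (X t e) \<le> norm (y e) + norm (csqrt (\<beta> * \<kappa> e)) + norm (\<beta> * \<kappa> e) / norm (v e)"
        "\<And>t e. t \<ge> 1 \<Longrightarrow> (X t e + of_real t * v e)\<^sup>2 = \<mu> (of_real t) e + of_real \<beta> * \<kappa> e" by metis
      define x where "x t e = (if e \<in> edges (Suc k) then X t e else 0)" for t e
      define B where "B = (\<Sum>e\<in>edges (Suc k). norm (y e) + norm (csqrt (\<beta> * \<kappa> e)) + norm (\<beta> * \<kappa> e) / norm (v e) + norm (v e))"
      have B0: "0 \<le> B" unfolding B_def by (intro sum_nonneg add_nonneg_nonneg) auto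
      have xB: "norm (x t e) + norm (v e) \<le> B" if "t \<ge> 1" for t e
      proof (cases "e \<in> edges (Suc k)")
        case True
        have "norm (x t e) + norm (v e) \<le> norm (y e) + norm (csqrt (\<beta> * \<kappa> e)) + norm (\<beta> * \<kappa> e) / norm (v e) + norm (v e)"
          using X(1)[OF that, of e] True by (simp add: x_def)
        also have "\<dots> \<le> B"
          unfolding B_def by (rule member_le_sum[OF True]) (auto simp: finite_edges intro!: add_nonneg_nonneg)
        finally show ?thesis .
      next
        case False
        then show ?thesis using v(2) B0 by (simp add: x_def edge_space_def)
      qed
      obtain C where C: "\<And>x :: nat set \<Rightarrow> complex. (\<And>e. norm (x e) \<le> B) \<Longrightarrow> norm (cm_det k x) \<le> C"
        using cm_det_bounded by blast
      have "norm (poly P (of_real t)) \<le> 3 * C * t\<^sup>2" if t: "t \<ge> 1" for t :: real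
      proof -
        have "x t \<in> edge_space (Suc k)" by (simp add: x_def edge_space_def)
        \<comment> \<open>The quadratic \<open>R\<close> changes with \<open>t\<close> and is tied
          to \<open>P\<close> only at the parameter \<open>t\<close>. The growth of \<open>P\<close>
          is still quadratic because all these \<open>R\<close> share one bound \<open>C\<close> at
          0, 1 and -1.\<close>
        then obtain R where R: "degree R \<le> 2" "\<And>s. poly R s = cm_det k (\<lambda>e. x t e + s * v e)"
          using v(1) unfolding quadratic_direction_def by blast
        have "poly P (of_real t) = poly R (of_real t)"
          unfolding P R f_gram cm_det_def
          by (rule det_mat_cong) (use X(2)[OF t] in \<open>simp add: gram_def x_def doubleton_in_edges\<close>)
        also have "norm \<dots> \<le> 3 * C * t\<^sup>2"
        proof (rule quadratic_growth[OF R(1) _ _ _ t])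
          have "norm (poly R s) \<le> C" if s: "norm s \<le> 1" for s
            unfolding R
          proof (rule C)
            fix e
            have "norm (x t e + s * v e) \<le> norm (x t e) + norm s * norm (v e)"
              using norm_triangle_ineq[of "x t e" "s * v e"] by (simp add: norm_mult)
            also have "\<dots> \<le> norm (x t e) + 1 * norm (v e)"
              using s by (intro add_left_mono mult_right_mono) auto
            finally show "norm (x t e + s * v e) \<le> B" using xB[OF t, of e] by simp
          qed
          then show "norm (poly R 0) \<le> C" "norm (poly R 1) \<le> C" "norm (poly R (-1)) \<le> C"
            by simp_all
        qed
        finally show ?thesis .
      qed
      then show ?thesis by blast
    qed
    then have "degree P \<le> 2" using degree_le_2_if_quadratic_growth by blast
    then obtain a b c where "P = [:a, b, c:]" by (rule poly_degree_le_2E)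
    then show ?thesis unfolding P[symmetric] by (simp add: algebra_simps)
  qed
  have lim: "((\<lambda>\<beta>. f \<beta> t / of_real \<beta> ^ (k - card W)) \<longlongrightarrow> H t) at_top" for t
  proof -
    have "H t = principal_minor W (N t)"
      unfolding H_def principal_minor_def
    proof (intro sum.cong refl arg_cong2[of _ _ _ _ "(*)"] prod.cong)
      fix p i assume "p \<in> {p. p permutes W}" "i \<in> W"
      then have "i \<in> W" "p i \<in> W" by (auto simp: permutes_in_image)
      then show "gram (\<lambda>e. (y e + t * v e)\<^sup>2) i (p i) = N t i (p i)"
        by (simp add: N_def gram_def \<mu>_def W0_def)
    qed
    then show ?thesis unfolding f_def using principal_minor_limit[OF W, of "N t"] by simp
  qed
  have "((\<lambda>\<beta>. f \<beta> 3 / of_real \<beta> ^ (k - card W) - 3 * (f \<beta> 2 / of_real \<beta> ^ (k - card W))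
      + 3 * (f \<beta> 1 / of_real \<beta> ^ (k - card W)) - f \<beta> 0 / of_real \<beta> ^ (k - card W)) \<longlongrightarrow>
      H 3 - 3 * H 2 + 3 * H 1 - H 0) at_top"
    by (intro tendsto_intros lim)
  moreover have "f \<beta> 3 / of_real \<beta> ^ (k - card W) - 3 * (f \<beta> 2 / of_real \<beta> ^ (k - card W))
      + 3 * (f \<beta> 1 / of_real \<beta> ^ (k - card W)) - f \<beta> 0 / of_real \<beta> ^ (k - card W) = 0" for \<beta>
    using arg_cong[OF third[of \<beta>], of "\<lambda>x. x / of_real \<beta> ^ (k - card W)"]
    by (simp add: add_divide_distrib diff_divide_distrib)
  ultimately have "((\<lambda>\<beta>::real. 0) \<longlongrightarrow> H 3 - 3 * H 2 + 3 * H 1 - H 0) at_top" by simp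
  then show ?thesis by (simp add: tendsto_const_iff)
qed

text \<open>Heron's quartic is a product of four linear forms, singular where two of them vanish,
  which is the conclusion. Base point 0 makes the quartic vanish at \<open>(a, b, c)\<close>, and
  the three unit base points make its partial derivatives vanish.\<close>

lemma quadratic_direction_triangle:
  assumes v: "quadratic_direction k v" "v \<in> edge_space (Suc k)" and ij: "i < k" "j < k" "i \<noteq> j"
  defines "a \<equiv> v {0, Suc i}" and "b \<equiv> v {0, Suc j}" and "c \<equiv> v {Suc i, Suc j}"
  shows "c = 0 \<and> a\<^sup>2 = b\<^sup>2 \<or> a = 0 \<and> b\<^sup>2 = c\<^sup>2 \<or> b = 0 \<and> a\<^sup>2 = c\<^sup>2"
proof -
  define h where "h x y z t = (x + t * a)\<^sup>2 * (y + t * b)\<^sup>2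
      - (((x + t * a)\<^sup>2 + (y + t * b)\<^sup>2 - (z + t * c)\<^sup>2) / 2)\<^sup>2" for x y z t
  have h: "h x y z 3 - 3 * h x y z 2 + 3 * h x y z 1 - h x y z 0 = 0" for x y z
  proof -
    define w where "w e = (if e = {0, Suc i} then x else if e = {0, Suc j} then y else z)" for e
    have ne: "{0, Suc i} \<noteq> {0, Suc j}" "{0, Suc i} \<noteq> {Suc i, Suc j}" "{0, Suc j} \<noteq> {Suc i, Suc j}"
      using ij by (auto simp: doubleton_eq_iff)
    have g: "principal_minor {i, j} (gram (\<lambda>e. (w e + t * v e)\<^sup>2)) = h x y z t" for t
      unfolding principal_minor_2[OF ij(3)] h_def
      using ij ne by (simp add: gram_def w_def a_def b_def c_def insert_commute power2_eq_square)
    show ?thesis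
      using quadratic_direction_minor[OF v, of "{i, j}" w] ij unfolding g by simp
  qed
  define K where "K = a\<^sup>2 * b\<^sup>2 - ((a\<^sup>2 + b\<^sup>2 - c\<^sup>2) / 2)\<^sup>2"
  \<comment> \<open>The third difference maps \<open>t ^ 4\<close> to 36, \<open>t ^ 3\<close> to 6
    and lower powers to 0.\<close>
  have "h 0 0 0 3 - 3 * h 0 0 0 2 + 3 * h 0 0 0 1 - h 0 0 0 0 = 36 * K"
    unfolding h_def K_def by (simp add: field_simps power2_eq_square)
  then have K: "K = 0" using h[of 0 0 0] by simp
  have "h 1 0 0 3 - 3 * h 1 0 0 2 + 3 * h 1 0 0 1 - h 1 0 0 0 = 36 * K + 6 * a * (b\<^sup>2 + c\<^sup>2 - a\<^sup>2)"
    unfolding h_def K_def by (simp add: field_simps power2_eq_square)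
  then have A: "a * (b\<^sup>2 + c\<^sup>2 - a\<^sup>2) = 0" using h[of 1 0 0] K by simp
  have "h 0 1 0 3 - 3 * h 0 1 0 2 + 3 * h 0 1 0 1 - h 0 1 0 0 = 36 * K + 6 * b * (a\<^sup>2 + c\<^sup>2 - b\<^sup>2)"
    unfolding h_def K_def by (simp add: field_simps power2_eq_square)
  then have B: "b * (a\<^sup>2 + c\<^sup>2 - b\<^sup>2) = 0" using h[of 0 1 0] K by simp
  have "h 0 0 1 3 - 3 * h 0 0 1 2 + 3 * h 0 0 1 1 - h 0 0 1 0 = 36 * K + 6 * c * (a\<^sup>2 + b\<^sup>2 - c\<^sup>2)"
    unfolding h_def K_def by (simp add: field_simps power2_eq_square)
  then have C: "c * (a\<^sup>2 + b\<^sup>2 - c\<^sup>2) = 0" using h[of 0 0 1] K by simp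
  show ?thesis
  proof (cases "a = 0 \<or> b = 0 \<or> c = 0")
    case True
    then show ?thesis using A B C by auto
  next
    case False
    then have "b\<^sup>2 + c\<^sup>2 - a\<^sup>2 = 0" "a\<^sup>2 + c\<^sup>2 - b\<^sup>2 = 0" using A B by simp_all
    moreover have "2 * c\<^sup>2 = (b\<^sup>2 + c\<^sup>2 - a\<^sup>2) + (a\<^sup>2 + c\<^sup>2 - b\<^sup>2)" by simp
    ultimately have "2 * c\<^sup>2 = 0" by (simp only: add_0_left)
    with False show ?thesis by simp
  qed
qed

text \<open>The triangle conditions admit the 4-cycle through 0, \<open>Suc b\<close>,
  \<open>Suc i\<close>, \<open>Suc b'\<close>; a 3 x 3 minor excludes it. The base point has the
  value \<open>s\<close> on one edge of the cycle, and adding the cases 1 and -1 cancels the term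
  odd in \<open>s\<close>.\<close>

lemma quadratic_direction_no_square:
  assumes v: "quadratic_direction k v" "v \<in> edge_space (Suc k)"
    and ij: "i < k" "b < k" "b' < k" "i \<noteq> b" "i \<noteq> b'" "b \<noteq> b'"
    and val: "v {0, Suc i} = 0" "v {Suc b, Suc b'} = 0" "(v {0, Suc b})\<^sup>2 = \<gamma>" "(v {0, Suc b'})\<^sup>2 = \<gamma>"
      "(v {Suc i, Suc b})\<^sup>2 = \<gamma>" "(v {Suc i, Suc b'})\<^sup>2 = \<gamma>"
  shows "\<gamma> = 0"
proof -
  define c where "c = v {Suc i, Suc b}"
  have c: "c\<^sup>2 = \<gamma>" using val by (simp add: c_def)
  define h where "h s t = - (\<gamma> * t\<^sup>2 * (2 * t * s * c + s\<^sup>2)\<^sup>2 / 4)" for s t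
  have h: "h s 3 - 3 * h s 2 + 3 * h s 1 - h s 0 = 0" for s
  proof -
    define w where "w e = (if e = {Suc i, Suc b} then s else 0)" for e
    have ne: "{0, Suc x} \<noteq> {Suc i, Suc b}" "{Suc i, Suc b'} \<noteq> {Suc i, Suc b}" "{Suc b, Suc b'} \<noteq> {Suc i, Suc b}" for x
      using ij by (auto simp: doubleton_eq_iff)
    let ?g = "\<lambda>t. gram (\<lambda>e. (w e + t * v e)\<^sup>2)"
    have e: "?g t i i = 0" "?g t b b = t\<^sup>2 * \<gamma>" "?g t b' b' = t\<^sup>2 * \<gamma>" "?g t b b' = t\<^sup>2 * \<gamma>"
      "?g t i b = - (2 * t * s * c + s\<^sup>2) / 2" "?g t i b' = 0" for t
      using ij ne val c by (simp_all add: gram_def w_def power_mult_distrib power2_sum flip: c_def)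
    have g: "principal_minor {i, b, b'} (?g t) = h s t" for t
      unfolding principal_minor_3[OF ij(4-6)] h_def gram_commute[of _ b i] gram_commute[of _ b' i] gram_commute[of _ b' b] e
      by (simp add: field_simps power2_eq_square)
    show ?thesis
      using quadratic_direction_minor[OF v, of "{i, b, b'}" w] ij unfolding g by simp
  qed
  have "h s 3 - 3 * h s 2 + 3 * h s 1 - h s 0 = - \<gamma> * (36 * s\<^sup>2 * c\<^sup>2 + 6 * s ^ 3 * c)" for s
    unfolding h_def by (simp add: field_simps power2_eq_square power3_eq_cube)
  then have "\<gamma> * (36 * c\<^sup>2 + 6 * c) = 0" "\<gamma> * (36 * c\<^sup>2 - 6 * c) = 0"
    using h[of 1] h[of "-1"] by auto
  moreover have "72 * (\<gamma> * \<gamma>) = \<gamma> * (36 * c\<^sup>2 + 6 * c) + \<gamma> * (36 * c\<^sup>2 - 6 * c)"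
    unfolding c by (simp add: algebra_simps)
  ultimately have "72 * (\<gamma> * \<gamma>) = 0" by (simp only: add_0_left)
  then show ?thesis by simp
qed

text \<open>By the triangle conditions the nonzero edges form the cut between the vertices
  \<open>Suc i\<close> with \<open>i \<in> B\<close> and the rest, which contains 0. A single vertex
  on one side means a star; two on each side contain the excluded 4-cycle.\<close>

lemma quadratic_direction_star_vec:
  assumes v: "quadratic_direction k v" "v \<in> edge_space (Suc k)" and nz: "v \<noteq> (\<lambda>_. 0)"
  obtains a where "star_vec (Suc k) a v"
proof -
  note tri = quadratic_direction_triangle[OF v]
  have out: "v e = 0" if "e \<notin> edges (Suc k)" for e using v(2) that by (simp add: edge_space_def)
  define B where "B = {i. i < k \<and> v {0, Suc i} \<noteq> 0}"
  have "B \<noteq> {}"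
  proof
    assume "B = {}"
    then have z: "v {0, Suc i} = 0" if "i < k" for i using that by (auto simp: B_def)
    have "v e = 0" for e
    proof (cases "e \<in> edges (Suc k)")
      case True
      then obtain x y where xy: "e = {x, y}" "x < y" "y < Suc k" by (rule edgesE)
      then obtain j where j: "y = Suc j" by (cases y) auto
      show ?thesis
      proof (cases x)
        case 0 then show ?thesis using xy j z by simp
      next
        case (Suc i) then show ?thesis using xy j z[of i] z[of j] tri[of i j] by auto
      qed
    qed (rule out)
    with nz show False by auto
  qed
  then obtain b where b: "b < k" "v {0, Suc b} \<noteq> 0" by (auto simp: B_def)
  define \<gamma> where "\<gamma> = (v {0, Suc b})\<^sup>2"
  have \<gamma>: "\<gamma> \<noteq> 0" using b by (simp add: \<gamma>_def)
  have zero: "(v {0, Suc i})\<^sup>2 = (if i \<in> B then \<gamma> else 0)" if "i < k" for i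
    using tri[of i b] b that by (cases "i = b") (auto simp: B_def \<gamma>_def)
  have pair: "(v {Suc i, Suc j})\<^sup>2 = (if (i \<in> B) \<noteq> (j \<in> B) then \<gamma> else 0)" if "i < k" "j < k" "i \<noteq> j" for i j
    using tri[of i j] that zero[of i] zero[of j] \<gamma> by (auto simp: B_def split: if_splits)
  have sq: "(v e)\<^sup>2 = (if e \<in> edges (Suc k) \<and> a \<in> e then \<gamma> else 0)"
    if "\<And>i. i < k \<Longrightarrow> i \<in> B \<longleftrightarrow> a \<in> {0, Suc i}"
      "\<And>i j. i < k \<Longrightarrow> j < k \<Longrightarrow> i \<noteq> j \<Longrightarrow> ((i \<in> B) \<noteq> (j \<in> B)) \<longleftrightarrow> a \<in> {Suc i, Suc j}" for a e
  proof (cases "e \<in> edges (Suc k)")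
    case True
    then obtain x y where xy: "e = {x, y}" "x < y" "y < Suc k" by (rule edgesE)
    then obtain j where j: "y = Suc j" by (cases y) auto
    show ?thesis
    proof (cases x)
      case 0 then show ?thesis using True xy j zero[of j] that(1)[of j] by auto
    next
      case (Suc i) then show ?thesis using True xy j pair[of i j] that(2)[of i j] by auto
    qed
  qed (simp add: out)
  consider "B = {0..<k}" | "B = {b}" | i b' where "i < k" "i \<notin> B" "b' \<in> B" "b' \<noteq> b"
  proof -
    have "b \<in> B" "B \<subseteq> {0..<k}" using b by (auto simp: B_def)
    then have "B = {0..<k} \<or> (\<exists>i<k. i \<notin> B)" "B = {b} \<or> (\<exists>b'\<in>B. b' \<noteq> b)" by auto
    then show ?thesis using that by blast
  qed
  then show ?thesis
  proof cases
    case 1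
    have "star_vec (Suc k) 0 v"
      unfolding star_vec_def using \<gamma> 1 by (intro conjI exI[of _ \<gamma>] allI sq) auto
    then show ?thesis by (rule that)
  next
    case 2
    have "star_vec (Suc k) (Suc b) v"
      unfolding star_vec_def using \<gamma> 2 b by (intro conjI exI[of _ \<gamma>] allI sq) auto
    then show ?thesis by (rule that)
  next
    case 3
    have bB: "b \<in> B" "b' < k" using b 3 by (auto simp: B_def)
    have "\<gamma> = 0"
      by (rule quadratic_direction_no_square[OF v, of i b b'])
        (use 3 b bB zero[of i] zero[of b] zero[of b'] pair[of i b] pair[of i b'] pair[of b b'] in auto)
    with \<gamma> show ?thesis by simp
  qed
qed

section \<open>Matrices mapping stars to stars\<close>

lemma mat_app_linear: "mat_app n A (\<lambda>e. x e + c * y e) = (\<lambda>e. mat_app n A x e + c * mat_app n A y e)"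
  by (auto simp: mat_app_def algebra_simps sum.distrib sum_distrib_left)

lemma mat_app_diff: "mat_app n A (\<lambda>e. x e - y e) e = mat_app n A x e - mat_app n A y e"
  using mat_app_linear[of n A x "-1" y] by (simp add: fun_eq_iff)

lemma mat_app_minus: "mat_app n A (\<lambda>e. - x e) = (\<lambda>e. - mat_app n A x e)"
  by (auto simp: mat_app_def sum_negf)

lemma nonsingular_inj:
  assumes "nonsingular n A" "x \<in> edge_space n" "y \<in> edge_space n" "mat_app n A x = mat_app n A y"
  shows "x = y"
proof -
  have "(\<lambda>e. x e - y e) \<in> edge_space n" using assms by (simp add: edge_space_def)
  moreover have "mat_app n A (\<lambda>e. x e - y e) = (\<lambda>_. 0)"
    using assms(4) by (simp add: mat_app_diff fun_eq_iff)
  ultimately have "(\<lambda>e. x e - y e) = (\<lambda>_. 0)" using assms(1) unfolding nonsingular_def by blast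
  then show ?thesis by (simp add: fun_eq_iff)
qed

lemma star_vec_nonzero_iff: "star_vec n a v \<Longrightarrow> v e \<noteq> 0 \<longleftrightarrow> e \<in> edges n \<and> a \<in> e"
  unfolding star_vec_def by (metis zero_eq_power2)

lemma star_vec_edge_space: "star_vec n a v \<Longrightarrow> v \<in> edge_space n"
  using star_vec_nonzero_iff[of n a v] by (auto simp: edge_space_def)

lemma star_vec_flip: "star_vec n a v \<Longrightarrow> star_vec n a (v(f := - v f))"
proof -
  have "((v(f := - v f)) e)\<^sup>2 = (v e)\<^sup>2" for e by simp
  then show "star_vec n a v \<Longrightarrow> star_vec n a (v(f := - v f))" unfolding star_vec_def by (simp only:)
qed

lemma star_vec_uminus: "star_vec n a v \<Longrightarrow> star_vec n a (\<lambda>e. - v e)"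
  unfolding star_vec_def by simp

text \<open>An edge from \<open>b\<close> to a third vertex shows that both stars have the same
  square; only the sign on \<open>{b, c}\<close> remains free.\<close>

lemma star_vec_eq_or_flip:
  assumes "star_vec n b w" "star_vec n b z" and bc: "b \<noteq> c" "c < n" "n \<ge> 3"
    and eq: "\<And>e. e \<in> edges n \<Longrightarrow> b \<in> e \<Longrightarrow> c \<notin> e \<Longrightarrow> z e = w e"
  shows "z = w \<or> z = w({b, c} := - w {b, c})"
proof -
  obtain \<gamma> where w: "\<And>e. (w e)\<^sup>2 = (if e \<in> edges n \<and> b \<in> e then \<gamma> else 0)" and b: "b < n"
    using assms(1) by (auto simp: star_vec_def)
  obtain \<delta> where z: "\<And>e. (z e)\<^sup>2 = (if e \<in> edges n \<and> b \<in> e then \<delta> else 0)"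
    using assms(2) by (auto simp: star_vec_def)
  have "card ({..<n} - {b, c}) \<ge> n - 2" using b bc by (simp add: card_Diff_subset)
  then obtain x where x: "x < n" "x \<noteq> b" "x \<noteq> c"
    using bc(3) by (cases "{..<n} - {b, c} = {}") auto
  then have "\<delta> = \<gamma>" using w[of "{b, x}"] z[of "{b, x}"] eq[of "{b, x}"] b bc by (auto simp: doubleton_in_edges)
  then have "(z {b, c})\<^sup>2 = (w {b, c})\<^sup>2" by (simp add: w z)
  then have "z {b, c} = w {b, c} \<or> z {b, c} = - w {b, c}" by (simp add: power2_eq_iff)
  moreover have rest: "z e = w e" if "e \<noteq> {b, c}" for e
  proof (cases "e \<in> edges n \<and> b \<in> e")
    case True
    then obtain y where "e = {b, y}" by (auto elim: edge_at)
    then have "c \<notin> e" using that bc by auto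
    with True eq show ?thesis by blast
  next
    case False
    then show ?thesis using w[of e] z[of e] by auto
  qed
  ultimately show ?thesis
  proof (elim disjE)
    assume "z {b, c} = w {b, c}"
    then have "z = w" using rest by (intro ext) metis
    then show ?thesis ..
  next
    assume "z {b, c} = - w {b, c}"
    then have "z = w({b, c} := - w {b, c})" using rest by (intro ext) simp
    then show ?thesis ..
  qed
qed

text \<open>The left side is nonzero on each edge \<open>{b, x}\<close> with \<open>x\<close>
  outside \<open>{b, c}\<close>. If \<open>b\<close> were neither centre on the right, every such
  \<open>x\<close> would be one; but there are at least three of them.\<close>

lemma star_vec_relation_center:
  assumes n: "n \<ge> 5" and bc: "b \<noteq> c"
    and st: "star_vec n b w" "star_vec n c w'" "star_vec n b\<^sub>2 u" "star_vec n c\<^sub>2 u'"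
    and rel: "\<And>e. w e - w' e = u e - u' e"
  shows "b = b\<^sub>2 \<or> b = c\<^sub>2"
proof (rule ccontr)
  assume neg: "\<not> ?thesis"
  have bn: "b < n" "c < n" using st by (auto simp: star_vec_def)
  have "{..<n} - {b, c} \<subseteq> {b\<^sub>2, c\<^sub>2}"
  proof
    fix x assume x: "x \<in> {..<n} - {b, c}"
    then have "w {b, x} \<noteq> 0" "w' {b, x} = 0"
      using st bn bc star_vec_nonzero_iff[OF st(1)] star_vec_nonzero_iff[OF st(2), of "{b, x}"]
      by (auto simp: doubleton_in_edges)
    then have "u {b, x} \<noteq> 0 \<or> u' {b, x} \<noteq> 0" using rel[of "{b, x}"] by auto
    then show "x \<in> {b\<^sub>2, c\<^sub>2}"
      using neg star_vec_nonzero_iff[OF st(3), of "{b, x}"] star_vec_nonzero_iff[OF st(4), of "{b, x}"] by auto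
  qed
  then have "card ({..<n} - {b, c}) \<le> card {b\<^sub>2, c\<^sub>2}" by (intro card_mono) auto
  also have "\<dots> \<le> 2" by (simp add: card_insert_if)
  finally show False using bn bc n by (simp add: card_Diff_subset)
qed

text \<open>With subscripts for flipped edges, v - v_f = v_g - v_fg. Comparing centres, one of v_g
  and -v_fg goes to a star at \<open>b\<close> that agrees with \<open>?w\<close> off
  \<open>{b, c}\<close>. Injectivity rules out \<open>?w\<close>, so this star is \<open>X\<close>.
  Two choices of \<open>g\<close> yield two different vectors with image \<open>X\<close>.\<close>

lemma star_center_flip:
  assumes n: "n \<ge> 5" and ns: "nonsingular n A"
    and stars: "\<And>a v. star_vec n a v \<Longrightarrow> \<exists>b. star_vec n b (mat_app n A v)"
    and v: "star_vec n a v" and f: "f \<in> edges n" "a \<in> f"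
    and b: "star_vec n b (mat_app n A v)" and c: "star_vec n c (mat_app n A (v(f := - v f)))"
  shows "b = c"
proof (rule ccontr)
  assume bc: "b \<noteq> c"
  let ?\<Phi> = "mat_app n A"
  let ?w = "?\<Phi> v"
  define X where "X = ?w({b, c} := - ?w {b, c})"
  have bn: "b < n" "c < n" "a < n" using b c v by (auto simp: star_vec_def)
  have inj: "x = y" if "?\<Phi> x = ?\<Phi> y" "x \<in> edge_space n" "y \<in> edge_space n" for x y
    using nonsingular_inj[OF ns] that by blast
  note es = star_vec_edge_space[OF v] star_vec_edge_space[OF star_vec_flip[OF v]]
    star_vec_edge_space[OF star_vec_flip[OF star_vec_flip[OF v]]]
    star_vec_edge_space[OF star_vec_uminus[OF v]]
    star_vec_edge_space[OF star_vec_uminus[OF star_vec_flip[OF star_vec_flip[OF v]]]]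
  have nz: "v g \<noteq> 0" if "g \<in> edges n" "a \<in> g" for g
    using star_vec_nonzero_iff[OF v] that by blast
  define v1 where "v1 g = v(g := - v g)" for g
  define v2 where "v2 g = (v(f := - v f))(g := - (v(f := - v f)) g)" for g
  have es': "v1 g \<in> edge_space n" "v2 g \<in> edge_space n" "(\<lambda>e. - v2 g e) \<in> edge_space n" for g
    unfolding v1_def v2_def using es by blast+
  have key: "?\<Phi> (v1 g) = X \<or> ?\<Phi> (\<lambda>e. - v2 g e) = X"
    if g: "g \<in> edges n" "a \<in> g" "g \<noteq> f" and h: "h \<in> edges n" "a \<in> h" "h \<noteq> f" "h \<noteq> g" for g h
  proof -
    obtain b\<^sub>2 where b2: "star_vec n b\<^sub>2 (?\<Phi> (v1 g))"
      using stars[OF star_vec_flip[OF v]] unfolding v1_def by blast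
    obtain c\<^sub>2 where c2: "star_vec n c\<^sub>2 (?\<Phi> (v2 g))"
      using stars[OF star_vec_flip[OF star_vec_flip[OF v]]] unfolding v2_def by blast
    have "(\<lambda>e. v e - (v(f := - v f)) e) = (\<lambda>e. v1 g e - v2 g e)"
      using g by (auto simp: v1_def v2_def)
    then have rel: "?w e - ?\<Phi> (v(f := - v f)) e = ?\<Phi> (v1 g) e - ?\<Phi> (v2 g) e" for e
      unfolding mat_app_diff[symmetric] by simp
    have "b = b\<^sub>2 \<or> b = c\<^sub>2"
      by (rule star_vec_relation_center[OF n bc b c b2 c2 rel])
    moreover have "c = c\<^sub>2 \<or> c = b\<^sub>2"
      using star_vec_relation_center[OF n bc[symmetric] c b c2 b2] rel by (metis minus_diff_eq)
    ultimately consider "b = b\<^sub>2" "c = c\<^sub>2" | "b = c\<^sub>2" "c = b\<^sub>2" using bc by blast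
    then show ?thesis
    proof cases
      case 1
      have "?\<Phi> (v1 g) e = ?w e" if "e \<in> edges n" "b \<in> e" "c \<notin> e" for e
        using that rel[of e] star_vec_nonzero_iff[OF c, of e] star_vec_nonzero_iff[OF c2, of e] 1 by auto
      then have "?\<Phi> (v1 g) = ?w \<or> ?\<Phi> (v1 g) = X"
        unfolding X_def using star_vec_eq_or_flip[OF b, of "?\<Phi> (v1 g)" c] b2 1 bc bn n by auto
      moreover have "?\<Phi> (v1 g) \<noteq> ?w"
      proof
        assume "?\<Phi> (v1 g) = ?w"
        then have "v1 g = v" by (rule inj) (use es es' in auto)
        then have "v1 g g = v g" by simp
        then show False using nz[OF g(1,2)] by (simp add: v1_def)
      qed
      ultimately show ?thesis by blast
    next
      case 2
      have m: "?\<Phi> (\<lambda>e. - v2 g e) = (\<lambda>e. - ?\<Phi> (v2 g) e)" by (rule mat_app_minus)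
      have "?\<Phi> (\<lambda>e. - v2 g e) e = ?w e" if "e \<in> edges n" "b \<in> e" "c \<notin> e" for e
        unfolding m
        using that rel[of e] star_vec_nonzero_iff[OF c, of e] star_vec_nonzero_iff[OF b2, of e] 2 by auto
      then have "?\<Phi> (\<lambda>e. - v2 g e) = ?w \<or> ?\<Phi> (\<lambda>e. - v2 g e) = X"
        unfolding X_def using star_vec_eq_or_flip[OF b, of "?\<Phi> (\<lambda>e. - v2 g e)" c] star_vec_uminus[OF c2] 2 bc bn n
        unfolding m by auto
      moreover have "?\<Phi> (\<lambda>e. - v2 g e) \<noteq> ?w"
      proof
        assume "?\<Phi> (\<lambda>e. - v2 g e) = ?w"
        then have "(\<lambda>e. - v2 g e) = v" by (rule inj) (use es es' in auto)
        then have "- v2 g h = v h" by (rule fun_cong)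
        then show False using nz[OF h(1,2)] h by (simp add: v2_def)
      qed
      ultimately show ?thesis by blast
    qed
  qed
  obtain x where x: "f = {a, x}" "x \<noteq> a" "x < n" using f by (auto elim: edge_at)
  have "card ({..<n} - {a, x}) \<ge> 3" using x bn n by (simp add: card_Diff_subset)
  then obtain Y where Y: "Y \<subseteq> {..<n} - {a, x}" "card Y = 3"
    using obtain_subset_with_card_n by metis
  then obtain p q r where pqr: "Y = {p, q, r}" "p \<noteq> q" "p \<noteq> r" "q \<noteq> r" by (auto simp: card_3_iff)
  \<comment> \<open>\<open>g\<close> and \<open>h\<close> give the two preimages of
    \<open>X\<close>; the sign at \<open>l\<close>, which no flip touches, separates
    \<open>v1 g\<close> from the negative of \<open>v2 h\<close>.\<close>
  define g where "g = {a, p}"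
  define h where "h = {a, q}"
  define l where "l = {a, r}"
  have g: "g \<in> edges n" "a \<in> g" "g \<noteq> f" and h: "h \<in> edges n" "a \<in> h" "h \<noteq> f" and l: "l \<in> edges n" "a \<in> l" "l \<noteq> f"
    and ne: "h \<noteq> g" "l \<noteq> g" "l \<noteq> h"
    using Y(1) pqr x bn by (auto simp: g_def h_def l_def doubleton_in_edges doubleton_eq_iff)
  have "?\<Phi> (v1 g) = X \<or> ?\<Phi> (\<lambda>e. - v2 g e) = X" by (rule key[OF g h ne(1)])
  moreover have "?\<Phi> (v1 h) = X \<or> ?\<Phi> (\<lambda>e. - v2 h e) = X" by (rule key[OF h g ne(1)[symmetric]])
  ultimately consider "?\<Phi> (v1 g) = ?\<Phi> (v1 h)" | "?\<Phi> (v1 g) = ?\<Phi> (\<lambda>e. - v2 h e)"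
    | "?\<Phi> (v1 h) = ?\<Phi> (\<lambda>e. - v2 g e)" | "?\<Phi> (\<lambda>e. - v2 g e) = ?\<Phi> (\<lambda>e. - v2 h e)" by metis
  then show False
  proof cases
    case 1
    then have "v1 g g = v1 h g" using inj[OF _ es'(1) es'(1)] by metis
    then show False using nz[OF g(1,2)] ne by (simp add: v1_def)
  next
    case 2
    then have "v1 g l = - v2 h l" using inj[OF _ es'(1) es'(3)] by metis
    then show False using nz[OF l(1,2)] ne l by (simp add: v1_def v2_def)
  next
    case 3
    then have "v1 h l = - v2 g l" using inj[OF _ es'(1) es'(3)] by metis
    then show False using nz[OF l(1,2)] ne l by (simp add: v1_def v2_def)
  next
    case 4
    then have "- v2 g g = - v2 h g" using inj[OF _ es'(3) es'(3)] by metis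
    then show False using nz[OF g(1,2)] ne g by (simp add: v2_def)
  qed
qed

lemma star_preserving_matrix:
  fixes A :: "nat set \<Rightarrow> nat set \<Rightarrow> complex"
  assumes n: "n \<ge> 5" and ns: "nonsingular n A"
    and row: "\<And>e. e \<in> edges n \<Longrightarrow> \<exists>f\<in>edges n. A e f \<noteq> 0"
    and stars: "\<And>a v. star_vec n a v \<Longrightarrow> \<exists>b. star_vec n b (mat_app n A v)"
  shows "\<exists>c s \<sigma>. c \<noteq> 0 \<and> (\<forall>e\<in>edges n. s e \<in> {1, -1}) \<and> \<sigma> permutes {..<n} \<and>
     (\<forall>e\<in>edges n. \<forall>f\<in>edges n. A e f = (if e = \<sigma> ` f then c * s e else 0))"
proof -
  let ?\<Phi> = "mat_app n A"
  define S :: "nat \<Rightarrow> nat set \<Rightarrow> complex" where "S a e = (if e \<in> edges n \<and> a \<in> e then 1 else 0)" for a e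
  have S: "star_vec n a (S a)" if "a < n" for a
    using that by (auto simp: star_vec_def S_def intro!: exI[of _ 1])
  then have "\<exists>b. star_vec n b (?\<Phi> (S a))" if "a < n" for a
    using that stars by blast
  then obtain \<tau> where \<tau>: "\<And>a. a < n \<Longrightarrow> star_vec n (\<tau> a) (?\<Phi> (S a))" by metis
  have \<tau>n: "\<tau> a < n" if "a < n" for a using \<tau>[OF that] by (simp add: star_vec_def)
  \<comment> \<open>Flipping \<open>f\<close> changes the image at \<open>e\<close> by
    \<open>2 * A e f\<close>, and both images are stars at \<open>\<tau> a\<close>. Applied to both
    ends of \<open>f\<close>, this leaves one edge per column once \<open>\<tau>\<close> is
    injective.\<close>
  have supp: "\<tau> a \<in> e" if ef: "e \<in> edges n" "f \<in> edges n" "A e f \<noteq> 0" "a \<in> f" for a e f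
  proof -
    have a: "a < n" using ef by (auto simp: edges_def)
    let ?S' = "(S a)(f := - S a f)"
    obtain b where "star_vec n b (?\<Phi> ?S')"
      using stars[OF star_vec_flip[OF S[OF a]]] by blast
    then have b: "star_vec n (\<tau> a) (?\<Phi> ?S')"
      using star_center_flip[OF n ns stars S[OF a] ef(2,4) \<tau>[OF a]] by simp
    have "?\<Phi> (S a) e - ?\<Phi> ?S' e = (\<Sum>g\<in>edges n. if g = f then 2 * A e f else 0)"
      unfolding mat_app_diff[symmetric] using ef
      by (auto simp: mat_app_def S_def intro!: sum.cong)
    also have "\<dots> = 2 * A e f" using ef finite_edges by simp
    finally have "?\<Phi> (S a) e \<noteq> 0 \<or> ?\<Phi> ?S' e \<noteq> 0" using ef by auto
    then show ?thesis
      using star_vec_nonzero_iff[OF \<tau>[OF a]] star_vec_nonzero_iff[OF b] by blast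
  qed
  have sum_S: "?\<Phi> (S a) e = (\<Sum>f | f \<in> edges n \<and> a \<in> f. A e f)" if "e \<in> edges n" for a e
    using that by (simp add: mat_app_def S_def finite_edges sum.inter_filter if_distrib cong: if_cong)
  have hit: "\<exists>f\<in>edges n. a \<in> f \<and> A e f \<noteq> 0" if "a < n" "e \<in> edges n" "\<tau> a \<in> e" for a e
  proof (rule ccontr)
    assume "\<not> ?thesis"
    then have "?\<Phi> (S a) e = 0" using sum_S[OF that(2)] by (auto intro!: sum.neutral)
    then show False using star_vec_nonzero_iff[OF \<tau>[OF that(1)]] that by blast
  qed
  \<comment> \<open>If \<open>z\<close> is missed, the edge \<open>{\<tau> a, z}\<close> must be
    reached from some column \<open>{a, b}\<close>, which forces \<open>\<tau> b = \<tau> a\<close>: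
    every vertex has a partner. But nonzero rows force all values other than \<open>z\<close>, so
    \<open>n\<close> vertices take \<open>n - 1\<close> values and only one pair can
    coincide.\<close>
  have onto: "\<tau> ` {..<n} = {..<n}"
  proof (rule ccontr)
    assume "\<tau> ` {..<n} \<noteq> {..<n}"
    then obtain z where z: "z < n" "z \<notin> \<tau> ` {..<n}" using \<tau>n by blast
    have partner: "\<exists>b<n. b \<noteq> a \<and> \<tau> b = \<tau> a" if a: "a < n" for a
    proof -
      have "{\<tau> a, z} \<in> edges n" using z \<tau>n a by (auto simp: doubleton_in_edges)
      then obtain f where f: "f \<in> edges n" "a \<in> f" "A {\<tau> a, z} f \<noteq> 0" using hit[OF a] by blast
      then obtain b where b: "f = {a, b}" "b \<noteq> a" "b < n" by (auto elim: edge_at)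
      have "\<tau> b \<in> {\<tau> a, z}" using supp[of "{\<tau> a, z}" f b] f b \<open>{\<tau> a, z} \<in> edges n\<close> by simp
      then show ?thesis using b z by auto
    qed
    have img: "\<tau> ` {..<n} = {..<n} - {z}"
    proof
      show "\<tau> ` {..<n} \<subseteq> {..<n} - {z}" using \<tau>n z by auto
      show "{..<n} - {z} \<subseteq> \<tau> ` {..<n}"
      proof
        fix y assume y: "y \<in> {..<n} - {z}"
        then have e: "{y, z} \<in> edges n" using z by (auto simp: doubleton_in_edges)
        then obtain f where f: "f \<in> edges n" "A {y, z} f \<noteq> 0" using row by blast
        then obtain a b where ab: "f = {a, b}" "b < n" "a < b" by (auto elim: edgesE)
        then have "\<tau> a \<in> {y, z}" using supp[OF e f(1) f(2), of a] by simp
        moreover have "\<tau> a \<noteq> z" using z ab by auto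
        ultimately show "y \<in> \<tau> ` {..<n}" using ab by auto
      qed
    qed
    have "0 < n" using n by simp
    then obtain b\<^sub>0 where b0: "b\<^sub>0 < n" "b\<^sub>0 \<noteq> 0" "\<tau> b\<^sub>0 = \<tau> 0" using partner by blast
    have "\<tau> ` {..<n} = \<tau> ` ({..<n} - {0})"
    proof
      show "\<tau> ` {..<n} \<subseteq> \<tau> ` ({..<n} - {0})"
      proof
        fix y assume "y \<in> \<tau> ` {..<n}"
        then obtain a where a: "a < n" "y = \<tau> a" by auto
        then have "y = \<tau> (if a = 0 then b\<^sub>0 else a)" "(if a = 0 then b\<^sub>0 else a) \<in> {..<n} - {0}"
          using b0 by auto
        then show "y \<in> \<tau> ` ({..<n} - {0})" by (rule image_eqI)
      qed
    qed auto
    moreover have "card ({..<n} - {z}) = card ({..<n} - {0})" using z n by simp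
    ultimately have "card (\<tau> ` ({..<n} - {0})) = card ({..<n} - {0})"
      using img by metis
    then have inj: "inj_on \<tau> ({..<n} - {0})" by (intro eq_card_imp_inj_on) auto
    have "card (\<tau> ` {..<n}) \<ge> 2" using img z n by simp
    then have "\<not> \<tau> ` {..<n} \<subseteq> {\<tau> 0}" using card_mono[of "{\<tau> 0}" "\<tau> ` {..<n}"] by auto
    then obtain a where a: "a < n" "\<tau> a \<noteq> \<tau> 0" by auto
    then obtain b where "b < n" "b \<noteq> a" "\<tau> b = \<tau> a" using partner by blast
    moreover from this a have "a \<noteq> 0" "b \<noteq> 0" by metis+
    ultimately show False using inj a by (auto simp: inj_on_def)
  qed
  then have inj: "inj_on \<tau> {..<n}" by (intro eq_card_imp_inj_on) auto
  define \<sigma> where "\<sigma> x = (if x < n then \<tau> x else x)" for x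
  have "bij_betw \<sigma> {..<n} {..<n}"
    using inj onto by (auto simp: \<sigma>_def bij_betw_def inj_on_def image_def)
  then have perm: "\<sigma> permutes {..<n}" by (rule bij_imp_permutes) (simp add: \<sigma>_def)
  have \<sigma>_edges: "\<sigma> ` f \<in> edges n" if f: "f \<in> edges n" for f
  proof -
    obtain a b where "f = {a, b}" "a < b" "b < n" using f by (rule edgesE)
    then show ?thesis
      using permutes_in_image[OF perm] permutes_inj[OF perm] by (auto simp: doubleton_in_edges inj_eq)
  qed
  have A_supp: "e = \<sigma> ` f" if ef: "e \<in> edges n" "f \<in> edges n" "A e f \<noteq> 0" for e f
  proof -
    have "\<sigma> ` f \<subseteq> e"
    proof
      fix y assume "y \<in> \<sigma> ` f"
      then obtain a where a: "a \<in> f" "y = \<sigma> a" by auto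
      then have "a < n" using ef by (auto simp: edges_def)
      then show "y \<in> e" using supp[OF ef a(1)] a by (simp add: \<sigma>_def)
    qed
    moreover have "card (\<sigma> ` f) = card e" "finite e"
      using ef \<sigma>_edges[OF ef(2)] by (auto simp: edges_def intro: finite_subset)
    ultimately show ?thesis using card_subset_eq by metis
  qed
  have "\<forall>a<n. \<exists>\<gamma>. \<gamma> \<noteq> 0 \<and> (\<forall>f\<in>edges n. a \<in> f \<longrightarrow> (A (\<sigma> ` f) f)\<^sup>2 = \<gamma>)"
  proof (intro allI impI)
    fix a assume a: "a < n"
    obtain \<gamma> where \<gamma>: "\<gamma> \<noteq> 0" "\<And>e. (?\<Phi> (S a) e)\<^sup>2 = (if e \<in> edges n \<and> \<tau> a \<in> e then \<gamma> else 0)"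
      using \<tau>[OF a] by (auto simp: star_vec_def)
    have "(A (\<sigma> ` f) f)\<^sup>2 = \<gamma>" if f: "f \<in> edges n" "a \<in> f" for f
    proof -
      have "A (\<sigma> ` f) g = 0" if "g \<in> edges n" "g \<noteq> f" for g
        using A_supp[OF \<sigma>_edges[OF f(1)] that(1)] that(2) permutes_inj[OF perm]
        by (auto simp: inj_image_eq_iff)
      then have "?\<Phi> (S a) (\<sigma> ` f) = (\<Sum>g | g \<in> edges n \<and> a \<in> g. if g = f then A (\<sigma> ` f) f else 0)"
        unfolding sum_S[OF \<sigma>_edges[OF f(1)]] by (intro sum.cong) auto
      also have "\<dots> = A (\<sigma> ` f) f" using f by (simp add: finite_edges)
      finally have "?\<Phi> (S a) (\<sigma> ` f) = A (\<sigma> ` f) f" .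
      moreover have "\<tau> a \<in> \<sigma> ` f" using f a by (force simp: \<sigma>_def)
      ultimately show ?thesis using \<gamma>(2)[of "\<sigma> ` f"] \<sigma>_edges[OF f(1)] by simp
    qed
    then show "\<exists>\<gamma>. \<gamma> \<noteq> 0 \<and> (\<forall>f\<in>edges n. a \<in> f \<longrightarrow> (A (\<sigma> ` f) f)\<^sup>2 = \<gamma>)" using \<gamma>(1) by blast
  qed
  then obtain \<gamma> where \<gamma>: "\<And>a. a < n \<Longrightarrow> \<gamma> a \<noteq> 0"
    "\<And>a f. a < n \<Longrightarrow> f \<in> edges n \<Longrightarrow> a \<in> f \<Longrightarrow> (A (\<sigma> ` f) f)\<^sup>2 = \<gamma> a" by metis
  \<comment> \<open>The column \<open>{0, a}\<close> lies in the stars at both ends, so one constant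
    serves the whole matrix.\<close>
  have \<gamma>0: "\<gamma> a = \<gamma> 0" if "a < n" for a
    using \<gamma>(2)[of a "{0, a}"] \<gamma>(2)[of 0 "{0, a}"] that
    by (cases "a = 0") (auto simp: doubleton_in_edges)
  define c where "c = csqrt (\<gamma> 0)"
  have c: "c\<^sup>2 = \<gamma> 0" "c \<noteq> 0" using \<gamma>(1)[of 0] n by (auto simp: c_def)
  have Ac: "(A (\<sigma> ` f) f)\<^sup>2 = c\<^sup>2" if f: "f \<in> edges n" for f
  proof -
    obtain a b where ab: "f = {a, b}" "a < b" "b < n" using f by (rule edgesE)
    then show ?thesis using \<gamma>(2)[of a f] \<gamma>0[of a] f c by simp
  qed
  define \<rho> where "\<rho> = inv_into UNIV \<sigma>"
  define s where "s e = A e (\<rho> ` e) / c" for e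
  have inv: "\<sigma> ` \<rho> ` e = e" "\<rho> ` \<sigma> ` e = e" for e
    using permutes_inverses[OF perm] by (auto simp: image_image \<rho>_def)
  have inv_edges: "\<rho> ` e \<in> edges n" if e: "e \<in> edges n" for e
  proof -
    obtain a b where "e = {a, b}" "a < b" "b < n" using e by (rule edgesE)
    then show ?thesis
      using permutes_in_image[OF permutes_inv[OF perm]] permutes_inj[OF permutes_inv[OF perm]]
      by (auto simp: doubleton_in_edges inj_eq \<rho>_def)
  qed
  have "s e \<in> {1, -1}" if "e \<in> edges n" for e
  proof -
    have "(s e)\<^sup>2 = 1" using Ac[OF inv_edges[OF that]] c(2) by (simp add: s_def inv power_divide)
    then show ?thesis by (simp add: power2_eq_1_iff)
  qed
  moreover have "A e f = (if e = \<sigma> ` f then c * s e else 0)" if "e \<in> edges n" "f \<in> edges n" for e f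
    using A_supp[OF that] c(2) by (auto simp: s_def inv)
  ultimately show ?thesis using c(2) perm by blast
qed

text \<open>Unit vectors in \<open>L\<close> make it span the edge space, so bijectivity on
  \<open>L\<close> yields surjectivity of the matrix.\<close>

lemma unit_vector_in_L_var:
  assumes d: "d \<ge> 2" and f: "f \<in> edges (d + 2)"
  shows "(\<lambda>e. if e = f then 1 else 0) \<in> L_var d"
proof -
  obtain a b where ab: "f = {a, b}" "a < b" "b < d + 2" using f by (rule edgesE)
  \<comment> \<open>\<open>a\<close> and \<open>b\<close> are sent to isotropic vectors at squared distance 1, all other points to the origin.\<close>
  define p :: "nat \<Rightarrow> nat \<Rightarrow> complex" where
    "p i k = (if k = 0 then (if i = a then 1/2 else if i = b then -1/2 else 0)
      else if k = 1 \<and> (i = a \<or> i = b) then \<i>/2 else 0)" for i k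
  have "((if e = f then 1 else 0)\<^sup>2 :: complex) = meas d p e" for e
  proof (cases "e \<in> edges (d + 2)")
    case True
    then obtain x y where xy: "e = {x, y}" "x < y" "y < d + 2" by (rule edgesE)
    have "meas d p e = (\<Sum>k<d. (p x k - p y k)\<^sup>2)"
      using xy by (simp add: meas_doubleton)
    also have "\<dots> = (\<Sum>k\<in>{0, 1}. (p x k - p y k)\<^sup>2)"
      by (rule sum.mono_neutral_right) (use d in \<open>auto simp: p_def\<close>)
    also have "\<dots> = (if e = f then 1 else 0)"
      using xy ab by (auto simp: p_def doubleton_eq_iff power2_eq_square field_simps)
    finally show ?thesis by simp
  next
    case False
    then show ?thesis using f by (auto simp: meas_def)
  qed
  then have "(\<lambda>e. ((if e = f then 1 else 0)\<^sup>2 :: complex)) = meas d p" by (rule ext)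
  then have "(\<lambda>e. ((if e = f then 1 else 0)\<^sup>2 :: complex)) \<in> M_var d"
    unfolding M_var_def by blast
  then show ?thesis using f by (auto simp: L_var_def edge_space_def)
qed

theorem theorem5p7:
  fixes d :: nat and A :: "nat set \<Rightarrow> nat set \<Rightarrow> complex"
  assumes "d \<ge> 3"
    and "linear_automorphism_L d A"
  shows "\<exists>c s \<sigma>. c \<noteq> 0 \<and> (\<forall>e\<in>edges (d+2). s e \<in> {1, -1}) \<and> \<sigma> permutes {..<d+2} \<and>
     (\<forall>e\<in>edges (d+2). \<forall>f\<in>edges (d+2). A e f = (if e = \<sigma> ` f then c * s e else 0))"
proof -
  let ?n = "d + 2"
  let ?\<Phi> = "mat_app ?n A"
  have ns: "nonsingular ?n A" and bij: "bij_betw ?\<Phi> (L_var d) (L_var d)"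
    using assms(2) by (auto simp: linear_automorphism_L_def)
  have range: "?\<Phi> x \<in> edge_space ?n" for x by (simp add: edge_space_def mat_app_def)
  have L_iff: "x \<in> L_var d \<longleftrightarrow> cm_det (d + 1) x = 0" if "x \<in> edge_space (Suc (d + 1))" for x
    using that by (intro L_var_iff_cm_det) simp
  have "cm_det (d + 1) (?\<Phi> x) = 0" if x: "x \<in> edge_space (Suc (d + 1))" "cm_det (d + 1) x = 0" for x
  proof -
    have "?\<Phi> x \<in> L_var d" using x L_iff bij by (auto simp: bij_betw_def)
    then show ?thesis using L_iff[of "?\<Phi> x"] range by simp
  qed
  then obtain \<mu> where \<mu>: "\<And>x. x \<in> edge_space (Suc (d + 1)) \<Longrightarrow> cm_det (d + 1) (?\<Phi> x) = \<mu> * cm_det (d + 1) x"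
    using cm_det_linear_preserver[of "d + 1" ?\<Phi>] mat_app_linear assms(1) by auto
  have "\<exists>l\<in>L_var d. ?\<Phi> l = (\<lambda>e. if e = f then 1 else 0)" if "f \<in> edges ?n" for f
  proof -
    have "(\<lambda>e. if e = f then 1 else 0) \<in> ?\<Phi> ` L_var d"
      using unit_vector_in_L_var[of d f] that assms(1) bij by (simp add: bij_betw_def)
    then show ?thesis by (auto simp: image_iff)
  qed
  then obtain l where l: "\<And>f. f \<in> edges ?n \<Longrightarrow> l f \<in> L_var d"
    "\<And>f. f \<in> edges ?n \<Longrightarrow> ?\<Phi> (l f) = (\<lambda>e. if e = f then 1 else 0)" by metis
  \<comment> \<open>Being a quadratic direction concerns every base point, so each \<open>x\<close>
    must be an image before the factor \<open>\<mu>\<close> can be applied.\<close>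
  have surj: "\<exists>x'\<in>edge_space ?n. ?\<Phi> x' = x" if x: "x \<in> edge_space ?n" for x
  proof
    let ?x' = "\<lambda>e. \<Sum>f\<in>edges ?n. x f * l f e"
    show "?x' \<in> edge_space ?n"
      using l(1) by (auto simp: edge_space_def L_var_def intro!: sum.neutral)
    show "?\<Phi> ?x' = x"
    proof
      fix e
      show "?\<Phi> ?x' e = x e"
      proof (cases "e \<in> edges ?n")
        case True
        have "?\<Phi> ?x' e = (\<Sum>g\<in>edges ?n. \<Sum>f\<in>edges ?n. x f * (A e g * l f g))"
          using True by (simp add: mat_app_def sum_distrib_left mult_ac)
        also have "\<dots> = (\<Sum>f\<in>edges ?n. x f * ?\<Phi> (l f) e)"
          using True by (subst sum.swap) (simp add: mat_app_def sum_distrib_left)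
        also have "\<dots> = (\<Sum>f\<in>edges ?n. if f = e then x e else 0)"
          using l(2) by (intro sum.cong refl) simp
        also have "\<dots> = x e" using True by (simp add: finite_edges)
        finally show ?thesis .
      next
        case False
        then show ?thesis using x by (auto simp: mat_app_def edge_space_def)
      qed
    qed
  qed
  have row: "\<exists>f\<in>edges ?n. A e f \<noteq> 0" if e: "e \<in> edges ?n" for e
  proof (rule ccontr)
    assume "\<not> ?thesis"
    then have "?\<Phi> (l e) e = 0" by (auto simp: mat_app_def intro!: sum.neutral)
    then show False using fun_cong[OF l(2)[OF e], of e] by simp
  qed
  have stars: "\<exists>b. star_vec ?n b (?\<Phi> v)" if v: "star_vec ?n a v" for a v
  proof -
    have ves: "v \<in> edge_space ?n" by (rule star_vec_edge_space[OF v])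
    have quad: "quadratic_direction (d + 1) v"
      using v by (intro star_vec_quadratic_direction[of _ a]) simp
    have "quadratic_direction (d + 1) (?\<Phi> v)"
      unfolding quadratic_direction_def
    proof
      fix x assume "x \<in> edge_space (Suc (d + 1))"
      then obtain x' where x': "x' \<in> edge_space ?n" "?\<Phi> x' = x" using surj by auto
      then obtain P where P: "degree P \<le> 2" "\<And>t. poly P t = cm_det (d + 1) (\<lambda>e. x' e + t * v e)"
        using quad unfolding quadratic_direction_def by auto
      have "cm_det (d + 1) (\<lambda>e. x e + t * ?\<Phi> v e) = poly (smult \<mu> P) t" for t
      proof -
        have "(\<lambda>e. x e + t * ?\<Phi> v e) = ?\<Phi> (\<lambda>e. x' e + t * v e)"
          unfolding mat_app_linear x'(2) ..
        moreover have "(\<lambda>e. x' e + t * v e) \<in> edge_space (Suc (d + 1))"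
          using x'(1) ves by (simp add: edge_space_def)
        ultimately show ?thesis by (simp only: \<mu> P(2) poly_smult)
      qed
      then show "\<exists>P. degree P \<le> 2 \<and> (\<forall>t. poly P t = cm_det (d + 1) (\<lambda>e. x e + t * ?\<Phi> v e))"
        using P(1) degree_smult_le[of \<mu> P] by (intro exI[of _ "smult \<mu> P"]) auto
    qed
    moreover have "?\<Phi> v \<noteq> (\<lambda>_. 0)"
    proof
      assume "?\<Phi> v = (\<lambda>_. 0)"
      then have "v = (\<lambda>_. 0)" using ns ves unfolding nonsingular_def by blast
      moreover have "{a, if a = 0 then 1 else 0} \<in> edges ?n"
        using v by (auto simp: star_vec_def doubleton_in_edges)
      ultimately show False
        using star_vec_nonzero_iff[OF v, of "{a, if a = 0 then 1 else 0}"] by simp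
    qed
    ultimately show ?thesis
      using quadratic_direction_star_vec[of "d + 1" "?\<Phi> v"] range by auto
  qed
  show ?thesis by (rule star_preserving_matrix[OF _ ns row stars]) (use assms(1) in auto)
qed

end
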